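(* If $G$ is an outerplanar graph with diameter $d$ and a resolving set of size $k$, then $G$ has order at most $2kd^2-2d^2+d+1=\mathcal{O}(kd^2)$.
   Context: A graph is outerplanar if it has a planar embedding with all vertices on the outer face. A set $R$ of vertices of a graph $G$ is a resolving set if for each pair $u,v$ of distinct vertices there is $x\in R$ with $d(x,u)\neq d(x,v)$. *)

theory Defs
  imports "HOL-Analysis.Analysis"
begin

text \<open>Simple graphs: finite vertex set V, symmetric irreflexive adjacency E (only
  the restriction of E to V matters).\<close>

definition simple_graph :: "'a set \<Rightarrow> ('a \<Rightarrow> 'a \<Rightarrow> bool) \<Rightarrow> bool" where
  "simple_graph V E \<longleftrightarrow> finite V \<and> (\<forall>u v. E u v \<longrightarrow> E v u) \<and> (\<forall>v. \<not> E v v)"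

definition edge_rel :: "'a set \<Rightarrow> ('a \<Rightarrow> 'a \<Rightarrow> bool) \<Rightarrow> ('a \<times> 'a) set" where
  "edge_rel V E = {(u, v). u \<in> V \<and> v \<in> V \<and> E u v}"

definition gdist :: "'a set \<Rightarrow> ('a \<Rightarrow> 'a \<Rightarrow> bool) \<Rightarrow> 'a \<Rightarrow> 'a \<Rightarrow> nat" where
  "gdist V E u v = (LEAST n. (u, v) \<in> edge_rel V E ^^ n)"

definition connected_graph :: "'a set \<Rightarrow> ('a \<Rightarrow> 'a \<Rightarrow> bool) \<Rightarrow> bool" where
  "connected_graph V E \<longleftrightarrow> (\<forall>u\<in>V. \<forall>v\<in>V. \<exists>n. (u, v) \<in> edge_rel V E ^^ n)"

definition has_diameter :: "'a set \<Rightarrow> ('a \<Rightarrow> 'a \<Rightarrow> bool) \<Rightarrow> nat \<Rightarrow> bool" where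
  "has_diameter V E d \<longleftrightarrow> V \<noteq> {} \<and> connected_graph V E \<and>
     d = Max {gdist V E u v | u v. u \<in> V \<and> v \<in> V}"

definition resolving_set :: "'a set \<Rightarrow> ('a \<Rightarrow> 'a \<Rightarrow> bool) \<Rightarrow> 'a set \<Rightarrow> bool" where
  "resolving_set V E R \<longleftrightarrow> R \<subseteq> V \<and>
     (\<forall>u\<in>V. \<forall>v\<in>V. u \<noteq> v \<longrightarrow> (\<exists>x\<in>R. gdist V E x u \<noteq> gdist V E x v))"

definition planar_drawing ::
  "'a set \<Rightarrow> ('a \<Rightarrow> 'a \<Rightarrow> bool) \<Rightarrow> ('a \<Rightarrow> complex) \<Rightarrow> ('a \<Rightarrow> 'a \<Rightarrow> real \<Rightarrow> complex) \<Rightarrow> bool" where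
  "planar_drawing V E pos \<gamma> \<longleftrightarrow>
     inj_on pos V \<and>
     (\<forall>u\<in>V. \<forall>v\<in>V. E u v \<longrightarrow>
        arc (\<gamma> u v) \<and> pathstart (\<gamma> u v) = pos u \<and> pathfinish (\<gamma> u v) = pos v \<and>
        \<gamma> v u = reversepath (\<gamma> u v) \<and>
        (\<forall>w\<in>V. pos w \<in> path_image (\<gamma> u v) \<longrightarrow> w = u \<or> w = v)) \<and>
     (\<forall>u\<in>V. \<forall>v\<in>V. \<forall>x\<in>V. \<forall>y\<in>V. E u v \<and> E x y \<and> {u, v} \<noteq> {x, y} \<longrightarrow>
        path_image (\<gamma> u v) \<inter> path_image (\<gamma> x y) \<subseteq> pos ` ({u, v} \<inter> {x, y}))"

definition drawing_image ::
  "'a set \<Rightarrow> ('a \<Rightarrow> 'a \<Rightarrow> bool) \<Rightarrow> ('a \<Rightarrow> complex) \<Rightarrow> ('a \<Rightarrow> 'a \<Rightarrow> real \<Rightarrow> complex) \<Rightarrow> complex set" where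
  "drawing_image V E pos \<gamma> =
     pos ` V \<union> (\<Union>{path_image (\<gamma> u v) | u v. u \<in> V \<and> v \<in> V \<and> E u v})"

text \<open>Outerplanar: there is a planar drawing with every vertex on the boundary of the
  outer (unbounded) face, i.e. in the closure of the unbounded part of the complement.\<close>
definition outerplanar :: "'a set \<Rightarrow> ('a \<Rightarrow> 'a \<Rightarrow> bool) \<Rightarrow> bool" where
  "outerplanar V E \<longleftrightarrow> (\<exists>pos \<gamma>. planar_drawing V E pos \<gamma> \<and>
     (\<forall>v\<in>V. pos v \<in> closure (outside (drawing_image V E pos \<gamma>))))"

end

theory Submission
  imports Defs
begin

text \<open>Fix r in R. An outerplanar graph has a linear order of its vertices that starts at r and in
  which no two edges cross: at a cut vertex two orders are glued, and one without cut vertices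
  has a Hamiltonian cycle whose chords do not cross, because in a drawing of a theta curve one of
  the three arcs lies inside the other two. If a precedes b and b precedes x, a geodesic from r
  to b meets every geodesic from a to x; so along a layer of vertices at a fixed distance
  from r, the distance to x first weakly decreases, up to the position of x, and then weakly
  increases. Hence x separates at most 2d consecutive pairs of the layer. Each consecutive pair is
  separated by one of the other k - 1 resolving vertices, so a layer has at most 1 + 2d(k - 1)
  vertices, and there are d layers besides r itself.\<close>

section \<open>Theta curves\<close>

text \<open>The outer-face condition enters through a single fact: a vertex inside a cycle of the
  drawing has a neighbourhood disjoint from the outer face. It excludes three parallel paths that
  each have an inner vertex (a subdivided K_{2,3}), and it forces chords of a cycle to be drawn
  inside it. The former yields the Hamiltonian cycle: an ear of a longest cycle could only attach at
  two neighbours on the cycle, and then it would lengthen the cycle. All of this happens in the one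
  given drawing, so no drawing of a subgraph has to be built. From the vertex order on, the argument
  is purely combinatorial: an edge keeps every walk that avoids its ends on one side of it. The
  order has to start at r so that r, a, b, x are in interleaved position whichever a is taken. The
  number 2d consists of d changes on each side of x, since distances from x to other vertices lie in
  1..d and the changes on one side all go the same way. The vertex r sees each of its own layers at
  constant distance, so it separates nothing there.\<close>

lemma connected_inside_or_outside:
  fixes S J :: "complex set"
  assumes "connected S" "closed J" "S \<inter> J = {}"
  shows "S \<subseteq> inside J \<or> S \<subseteq> outside J"
proof (rule ccontr)
  assume "\<not> ?thesis"
  moreover have "S \<subseteq> inside J \<union> outside J"
    using assms(3) by auto
  ultimately have "inside J \<inter> S \<noteq> {}" "outside J \<inter> S \<noteq> {}"
    by blast+
  then show False
    using connectedD[OF assms(1) open_inside[OF assms(2)] open_outside[OF assms(2)]] \<open>S \<subseteq> _\<close>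
    by auto
qed

definition theta ::
  "(real \<Rightarrow> complex) \<Rightarrow> (real \<Rightarrow> complex) \<Rightarrow> (real \<Rightarrow> complex) \<Rightarrow> complex \<Rightarrow> complex \<Rightarrow> bool" where
  "theta c1 c2 c3 a b \<longleftrightarrow>
     (\<forall>c\<in>{c1, c2, c3}. arc c \<and> pathstart c = a \<and> pathfinish c = b) \<and>
     path_image c1 \<inter> path_image c2 = {a, b} \<and>
     path_image c1 \<inter> path_image c3 = {a, b} \<and>
     path_image c2 \<inter> path_image c3 = {a, b}"

lemma theta_swap12: "theta c1 c2 c3 a b \<Longrightarrow> theta c2 c1 c3 a b"
  and theta_swap23: "theta c1 c2 c3 a b \<Longrightarrow> theta c1 c3 c2 a b"
  unfolding theta_def by auto

lemma theta_closed:
  assumes "theta c1 c2 c3 a b"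
  shows "closed (path_image c1)"
  using assms unfolding theta_def by (auto simp: closed_arc_image)

lemma theta_endless_connected:
  assumes "theta c1 c2 c3 a b"
  shows "connected (path_image c3 - {a, b})"
  using assms connected_simple_path_endless[OF arc_imp_simple_path, of c3]
  unfolding theta_def by auto

lemma theta_Jordan:
  assumes "theta c1 c2 c3 a b"
  shows "inside (path_image c1 \<union> path_image c2) \<noteq> {}"
    and "connected (inside (path_image c1 \<union> path_image c2))"
    and "frontier (inside (path_image c1 \<union> path_image c2)) = path_image c1 \<union> path_image c2"
proof -
  have "simple_path (c1 +++ reversepath c2)"
    using assms unfolding theta_def
    by (intro simple_path_join_loop) (auto simp: arc_reversepath)
  moreover have "pathfinish (c1 +++ reversepath c2) = pathstart (c1 +++ reversepath c2)"
    using assms unfolding theta_def by auto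
  moreover have "path_image (c1 +++ reversepath c2) = path_image c1 \<union> path_image c2"
    using assms unfolding theta_def by (simp add: path_image_join)
  ultimately show "inside (path_image c1 \<union> path_image c2) \<noteq> {}"
    "connected (inside (path_image c1 \<union> path_image c2))"
    "frontier (inside (path_image c1 \<union> path_image c2)) = path_image c1 \<union> path_image c2"
    using Jordan_inside_outside[of "c1 +++ reversepath c2"] by auto
qed

lemma theta_inside_or_outside:
  assumes "theta c1 c2 c3 a b"
  shows "path_image c3 - {a, b} \<subseteq> inside (path_image c1 \<union> path_image c2) \<or>
         path_image c3 - {a, b} \<subseteq> outside (path_image c1 \<union> path_image c2)"
proof (rule connected_inside_or_outside)
  show "connected (path_image c3 - {a, b})"
    by (rule theta_endless_connected[OF assms])
  show "closed (path_image c1 \<union> path_image c2)"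
    using theta_closed[OF assms] theta_closed[OF theta_swap12[OF assms]] by (rule closed_Un)
  show "(path_image c3 - {a, b}) \<inter> (path_image c1 \<union> path_image c2) = {}"
    using assms unfolding theta_def by blast
qed

lemma theta_arc_nontrivial:
  assumes "theta c1 c2 c3 a b"
  shows "path_image c3 - {a, b} \<noteq> {}"
  using assms nonempty_simple_path_endless[OF arc_imp_simple_path, of c3]
  unfolding theta_def by auto

text \<open>The region bounded by the last two arcs is connected and misses the first arc, so it
  lies on one side of the cycle formed by the first two. It cannot be the inner side: the third arc
  belongs to its frontier and would lie in the closure of that inside.\<close>

lemma theta_inside_subset_outside:
  assumes th: "theta c1 c2 c3 a b"
    and o1: "path_image c1 - {a, b} \<subseteq> outside (path_image c2 \<union> path_image c3)"
    and o3: "path_image c3 - {a, b} \<subseteq> outside (path_image c1 \<union> path_image c2)"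
  shows "inside (path_image c2 \<union> path_image c3) \<subseteq> outside (path_image c1 \<union> path_image c2)"
proof -
  let ?D = "inside (path_image c2 \<union> path_image c3)"
  have th': "theta c2 c3 c1 a b"
    using th theta_swap12 theta_swap23 by blast
  have closed: "closed (path_image c1 \<union> path_image c2)"
    using theta_closed[OF th] theta_closed[OF theta_swap12[OF th]] by (rule closed_Un)
  have ab: "{a, b} \<subseteq> path_image c2"
    using th unfolding theta_def by blast
  have dis: "?D \<inter> (path_image c2 \<union> path_image c3) = {}"
    by (metis inf_commute inside_no_overlap)
  have "?D \<inter> path_image c1 = {}"
    using o1 dis ab inside_Int_outside[of "path_image c2 \<union> path_image c3"] by blast
  then have "?D \<subseteq> inside (path_image c1 \<union> path_image c2) \<or> ?thesis"
    using dis by (intro connected_inside_or_outside theta_Jordan(2)[OF th'] closed) blast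
  moreover have False if sub: "?D \<subseteq> inside (path_image c1 \<union> path_image c2)"
  proof -
    have "path_image c3 - {a, b} \<subseteq> closure ?D"
      using theta_Jordan(3)[OF th'] unfolding frontier_def by blast
    also have "\<dots> \<subseteq> closure (inside (path_image c1 \<union> path_image c2))"
      by (rule closure_mono[OF sub])
    also have "\<dots> \<subseteq> - outside (path_image c1 \<union> path_image c2)"
      using closure_inside_subset[OF closed] union_with_inside by blast
    finally show False
      using o3 theta_arc_nontrivial[OF th] by blast
  qed
  ultimately show ?thesis by blast
qed

text \<open>If no arc were inside the other two, a point x inside the second and third arc would be
  outside both cycles through the first arc; these meet in that arc alone, so Janiszewski's
  theorem would connect x to infinity off the whole theta curve.\<close>

lemma theta_one_inside:
  assumes th: "theta c1 c2 c3 a b"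
  shows "path_image c1 - {a, b} \<subseteq> inside (path_image c2 \<union> path_image c3) \<or>
         path_image c2 - {a, b} \<subseteq> inside (path_image c1 \<union> path_image c3) \<or>
         path_image c3 - {a, b} \<subseteq> inside (path_image c1 \<union> path_image c2)"
proof (rule ccontr)
  assume neg: "\<not> ?thesis"
  let ?P1 = "path_image c1" let ?P2 = "path_image c2" let ?P3 = "path_image c3"
  have th': "theta c1 c3 c2 a b" "theta c2 c3 c1 a b"
    using th theta_swap12 theta_swap23 by blast+
  have o1: "?P1 - {a, b} \<subseteq> outside (?P2 \<union> ?P3)"
    using theta_inside_or_outside[OF th'(2)] neg by blast
  have o2: "?P2 - {a, b} \<subseteq> outside (?P1 \<union> ?P3)"
    using theta_inside_or_outside[OF th'(1)] neg by blast
  have o3: "?P3 - {a, b} \<subseteq> outside (?P1 \<union> ?P2)"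
    using theta_inside_or_outside[OF th] neg by blast
  obtain x where x: "x \<in> inside (?P2 \<union> ?P3)"
    using theta_Jordan(1)[OF th'(2)] by blast
  have x2: "x \<in> outside (?P1 \<union> ?P2)"
    using theta_inside_subset_outside[OF th o1 o3] x by blast
  have x3: "x \<in> outside (?P1 \<union> ?P3)"
    using theta_inside_subset_outside[OF th'(1) _ o2] o1 x by (auto simp: Un_commute)
  have compact: "compact ?P1" "compact ?P2" "compact ?P3"
    using th unfolding theta_def by (auto simp: compact_arc_image)
  have comp12: "compact (?P1 \<union> ?P2)" and comp13: "compact (?P1 \<union> ?P3)"
    using compact by (auto intro: compact_Un)
  have "bounded (?P1 \<union> ?P2 \<union> ?P3)"
    using compact by (simp add: compact_imp_bounded)
  then obtain y where y: "y \<in> outside (?P1 \<union> ?P2 \<union> ?P3)"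
    using outside_bounded_nonempty by blast
  have ymono: "y \<in> outside T" if "T \<subseteq> ?P1 \<union> ?P2 \<union> ?P3" for T
    using y outside_mono[OF that] by blast
  have cc: "connected_component (- T) x y"
    if "compact T" "x \<in> outside T" "T \<subseteq> ?P1 \<union> ?P2 \<union> ?P3" for T
  proof -
    have "connected (outside T)"
      using that by (simp add: connected_outside compact_imp_bounded)
    moreover have "outside T \<subseteq> - T"
      using outside_no_overlap[of T] by blast
    ultimately show ?thesis
      unfolding connected_component_def using that ymono by blast
  qed
  have "(?P1 \<union> ?P2) \<inter> (?P1 \<union> ?P3) = ?P1"
    using th unfolding theta_def by blast
  moreover have "connected ?P1"
    using th unfolding theta_def by (auto simp: connected_arc_image)
  ultimately have "connected_component (- ((?P1 \<union> ?P2) \<union> (?P1 \<union> ?P3))) x y"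
    using x2 x3 comp12 comp13 compact_imp_closed
    by (intro Janiszewski cc) auto
  then have "connected_component (- (?P2 \<union> ?P3)) x y"
    by (rule connected_component_of_subset) auto
  then have "connected_component (- (?P2 \<union> ?P3)) y x"
    by (simp add: connected_component_sym)
  then have "x \<in> outside (?P2 \<union> ?P3)"
    using outside_same_component ymono[of "?P2 \<union> ?P3"] by blast
  with x show False
    using inside_Int_outside by blast
qed

text \<open>The inside of \<open>J\<close> is open and disjoint from the outside of every superset
  of \<open>J\<close>, hence also from the closure of that outside. With \<open>X\<close> the whole
  drawing, this forbids vertices inside any cycle of an outerplanar drawing.\<close>

lemma inside_not_in_closure_outside:
  assumes "z \<in> inside J" "closed J" "J \<subseteq> X"
  shows "(z :: complex) \<notin> closure (outside X)"
proof
  assume "z \<in> closure (outside X)"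
  moreover have "open (inside J)"
    by (rule open_inside[OF assms(2)])
  ultimately have "inside J \<inter> outside X \<noteq> {}"
    using assms(1) by (meson closure_iff_nhds_not_empty disjoint_iff subset_refl)
  then show False
    using outside_mono[OF assms(3)] inside_Int_outside[of J] by blast
qed

lemma theta_not_all_outer:
  assumes th: "theta c1 c2 c3 a b"
    and X: "path_image c1 \<union> path_image c2 \<union> path_image c3 \<subseteq> X"
    and z: "z1 \<in> path_image c1 - {a, b}" "z2 \<in> path_image c2 - {a, b}"
      "z3 \<in> path_image c3 - {a, b}"
    and "{z1, z2, z3} \<subseteq> closure (outside X)"
  shows False
proof -
  have "closed (path_image c1 \<union> path_image c2)" "closed (path_image c1 \<union> path_image c3)"
    "closed (path_image c2 \<union> path_image c3)"
    using th unfolding theta_def by (auto simp: closed_arc_image)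
  then show False
    using theta_one_inside[OF th] assms(3-) X inside_not_in_closure_outside by blast
qed

text \<open>The third arc needs no marked point: it is to be the drawing of a single edge, without
  vertices in its interior. Either of the other two, if enclosed, would hide its own marked point
  from the outer face.\<close>

lemma theta_third_inside:
  assumes th: "theta c1 c2 c3 a b"
    and X: "path_image c1 \<union> path_image c2 \<union> path_image c3 \<subseteq> X"
    and z: "z1 \<in> path_image c1 - {a, b}" "z2 \<in> path_image c2 - {a, b}"
    and "{z1, z2} \<subseteq> closure (outside X)"
  shows "path_image c3 - {a, b} \<subseteq> inside (path_image c1 \<union> path_image c2)"
proof -
  have "closed (path_image c1 \<union> path_image c3)" "closed (path_image c2 \<union> path_image c3)"
    using th unfolding theta_def by (auto simp: closed_arc_image)
  then show ?thesis
    using theta_one_inside[OF th] assms(3-) X inside_not_in_closure_outside by blast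
qed

text \<open>The arc \<open>c3\<close> cuts the inside of the cycle into two regions. A connected
  \<open>Q\<close> off \<open>c3\<close> stays in one of them, and the closure of that region misses
  the interior of \<open>c1\<close> or that of \<open>c2\<close>.\<close>

lemma theta_chord_separates:
  assumes th: "theta c1 c2 c3 a b"
    and c3: "path_image c3 - {a, b} \<subseteq> inside (path_image c1 \<union> path_image c2)"
    and Q: "connected Q" "Q \<inter> path_image c3 = {}" "Q \<subseteq> inside (path_image c1 \<union> path_image c2)"
    and z: "z1 \<in> path_image c1 - {a, b}" "z2 \<in> path_image c2 - {a, b}"
    and cl: "{z1, z2} \<subseteq> closure Q"
  shows False
proof -
  let ?P1 = "path_image c1" let ?P2 = "path_image c2" let ?P3 = "path_image c3"
  have arcs: "simple_path c1" "pathstart c1 = a" "pathfinish c1 = b"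
    "simple_path c2" "pathstart c2 = a" "pathfinish c2 = b"
    "simple_path c3" "pathstart c3 = a" "pathfinish c3 = b" "a \<noteq> b"
    "?P1 \<inter> ?P2 = {a, b}" "?P1 \<inter> ?P3 = {a, b}" "?P2 \<inter> ?P3 = {a, b}"
    using th arc_distinct_ends[of c1] unfolding theta_def by (auto simp: arc_imp_simple_path)
  have "?P3 \<inter> inside (?P1 \<union> ?P2) \<noteq> {}"
    using theta_arc_nontrivial[OF th] c3 by blast
  then have split: "inside (?P1 \<union> ?P3) \<union> inside (?P2 \<union> ?P3) \<union> (?P3 - {a, b}) = inside (?P1 \<union> ?P2)"
    using split_inside_simple_closed_curve[OF arcs] by metis
  have closed: "closed (?P1 \<union> ?P3)" "closed (?P2 \<union> ?P3)"
    using th unfolding theta_def by (auto simp: closed_arc_image)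
  have dis: "inside (?P1 \<union> ?P2) \<inter> (?P1 \<union> ?P2) = {}"
    by (metis inf_commute inside_no_overlap)
  have "Q \<subseteq> inside (?P1 \<union> ?P3) \<or> Q \<subseteq> outside (?P1 \<union> ?P3)"
    using Q dis by (intro connected_inside_or_outside closed) blast+
  then have "Q \<subseteq> inside (?P1 \<union> ?P3) \<or> Q \<subseteq> inside (?P2 \<union> ?P3)"
    using Q split inside_Int_outside[of "?P1 \<union> ?P3"] by blast
  then have "closure Q \<subseteq> (?P1 \<union> ?P3) \<union> inside (?P1 \<union> ?P3) \<or>
      closure Q \<subseteq> (?P2 \<union> ?P3) \<union> inside (?P2 \<union> ?P3)"
    using closure_mono closure_inside_subset[OF closed(1)] closure_inside_subset[OF closed(2)]
    by blast
  then show False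
    using cl z split dis arcs(11-13) by blast
qed

section \<open>Paths in an outerplanar drawing\<close>

definition steps :: "'a list \<Rightarrow> ('a \<times> 'a) set" where
  "steps xs = set (zip xs (tl xs))"

lemma steps_Nil [simp]: "steps [] = {}"
  and steps_single [simp]: "steps [x] = {}"
  and steps_Cons_Cons [simp]: "steps (x # y # xs) = insert (x, y) (steps (y # xs))"
  by (auto simp: steps_def)

lemma steps_Cons: "steps (x # xs) = (if xs = [] then {} else insert (x, hd xs) (steps xs))"
  by (cases xs) auto

lemma steps_append:
  "steps (xs @ ys) = steps xs \<union> steps ys \<union> (if xs = [] \<or> ys = [] then {} else {(last xs, hd ys)})"
  by (induction xs) (auto simp: steps_Cons)

lemma steps_rev: "steps (rev xs) = (steps xs)\<inverse>"
  by (induction xs) (auto simp: steps_append steps_Cons last_rev)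

lemma steps_subset: "steps xs \<subseteq> set xs \<times> set xs"
  by (auto simp: steps_def dest: set_zip_leftD set_zip_rightD intro: list.set_sel(2))

lemma steps_split: "steps (xs @ y # ys) = steps (xs @ [y]) \<union> steps (y # ys)"
  by (auto simp: steps_append steps_Cons)

section \<open>Vertex paths drawn as arcs\<close>

locale outerplanar_drawing =
  fixes V :: "'a set" and E :: "'a \<Rightarrow> 'a \<Rightarrow> bool"
    and pos :: "'a \<Rightarrow> complex" and \<gamma> :: "'a \<Rightarrow> 'a \<Rightarrow> real \<Rightarrow> complex"
  assumes simple: "simple_graph V E"
    and drawing: "planar_drawing V E pos \<gamma>"
    and outer: "\<And>v. v \<in> V \<Longrightarrow> pos v \<in> closure (outside (drawing_image V E pos \<gamma>))"
begin

lemma finite_V: "finite V" and E_sym: "E u v \<Longrightarrow> E v u"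
  using simple unfolding simple_graph_def by auto

lemma pos_inj: "u \<in> V \<Longrightarrow> v \<in> V \<Longrightarrow> pos u = pos v \<longleftrightarrow> u = v"
  using drawing unfolding planar_drawing_def inj_on_def by auto

lemma edge_arc:
  assumes "u \<in> V" "v \<in> V" "E u v"
  shows "arc (\<gamma> u v)" "pathstart (\<gamma> u v) = pos u" "pathfinish (\<gamma> u v) = pos v"
    "\<gamma> v u = reversepath (\<gamma> u v)"
  using drawing assms unfolding planar_drawing_def by auto

lemma edge_ends:
  assumes "u \<in> V" "v \<in> V" "E u v"
  shows "pos u \<in> path_image (\<gamma> u v)" "pos v \<in> path_image (\<gamma> u v)"
  using edge_arc[OF assms] pathstart_in_path_image pathfinish_in_path_image by metis+

lemma edges_meet:
  assumes "u \<in> V" "v \<in> V" "x \<in> V" "y \<in> V" "E u v" "E x y" "{u, v} \<noteq> {x, y}"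
  shows "path_image (\<gamma> u v) \<inter> path_image (\<gamma> x y) \<subseteq> pos ` ({u, v} \<inter> {x, y})"
  using drawing assms unfolding planar_drawing_def by blast

definition gpath :: "'a list \<Rightarrow> bool" where
  "gpath xs \<longleftrightarrow> distinct xs \<and> set xs \<subseteq> V \<and> (\<forall>(u, v)\<in>steps xs. E u v)"

text \<open>Only edges contribute, so a path with one vertex has empty image; hence the bounds
  \<open>length xs \<ge> 2\<close> below.\<close>

definition walk_image :: "'a list \<Rightarrow> complex set" where
  "walk_image xs = (\<Union>(u, v)\<in>steps xs. path_image (\<gamma> u v))"

lemma gpath_steps:
  assumes "gpath xs" "(u, v) \<in> steps xs"
  shows "u \<in> V" "v \<in> V" "E u v" "u \<in> set xs" "v \<in> set xs"
  using assms steps_subset[of xs] unfolding gpath_def by auto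

lemma gpath_rev: "gpath (rev xs) \<longleftrightarrow> gpath xs"
proof -
  have "(\<forall>(u, v)\<in>(steps xs)\<inverse>. E u v) \<longleftrightarrow> (\<forall>(u, v)\<in>steps xs. E u v)"
    using E_sym by blast
  then show ?thesis
    unfolding gpath_def steps_rev by simp
qed

lemma walk_image_subset_drawing: "gpath xs \<Longrightarrow> walk_image xs \<subseteq> drawing_image V E pos \<gamma>"
proof
  fix z assume gp: "gpath xs" and "z \<in> walk_image xs"
  then obtain u v where "(u, v) \<in> steps xs" "z \<in> path_image (\<gamma> u v)"
    unfolding walk_image_def by auto
  with gpath_steps(1-3)[OF gp] show "z \<in> drawing_image V E pos \<gamma>"
    unfolding drawing_image_def by blast
qed

lemma pos_in_walk_image:
  "gpath xs \<Longrightarrow> length xs \<ge> 2 \<Longrightarrow> v \<in> set xs \<Longrightarrow> pos v \<in> walk_image xs"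
proof (induction xs)
  case (Cons x xs)
  then obtain y ys where xs: "xs = y # ys"
    by (cases xs) auto
  have gp: "gpath (y # ys)" and xy: "x \<in> V" "y \<in> V" "E x y"
    using Cons.prems(1) unfolding xs gpath_def by auto
  show ?case
  proof (cases "v \<in> {x, y}")
    case True
    then show ?thesis
      using edge_ends[OF xy] unfolding xs walk_image_def by auto
  next
    case False
    then have "pos v \<in> walk_image xs"
      using Cons xs gp by (cases ys) auto
    then show ?thesis
      unfolding xs walk_image_def by auto
  qed
qed simp

text \<open>Steps are ordered pairs, while both directions of an edge have the same image; the two
  paths must therefore share no step in either direction before the drawing condition on distinct
  edges applies.\<close>

lemma walk_images_meet:
  assumes "gpath xs" "gpath ys" "steps xs \<inter> (steps ys \<union> (steps ys)\<inverse>) = {}"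
  shows "walk_image xs \<inter> walk_image ys \<subseteq> pos ` (set xs \<inter> set ys)"
proof
  fix z assume "z \<in> walk_image xs \<inter> walk_image ys"
  then obtain u v x y where *: "(u, v) \<in> steps xs" "(x, y) \<in> steps ys"
    "z \<in> path_image (\<gamma> u v) \<inter> path_image (\<gamma> x y)"
    unfolding walk_image_def by auto
  moreover have "{u, v} \<noteq> {x, y}"
    using assms(3) * by (auto simp: doubleton_eq_iff)
  ultimately have "z \<in> pos ` ({u, v} \<inter> {x, y})"
    using edges_meet[of u v x y] gpath_steps[OF assms(1), of u v] gpath_steps[OF assms(2), of x y]
    by blast
  then show "z \<in> pos ` (set xs \<inter> set ys)"
    using gpath_steps(4,5)[OF assms(1) *(1)] gpath_steps(4,5)[OF assms(2) *(2)] by blast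
qed

lemma gpath_arc:
  "gpath xs \<Longrightarrow> length xs \<ge> 2 \<Longrightarrow>
   \<exists>g. arc g \<and> pathstart g = pos (hd xs) \<and> pathfinish g = pos (last xs) \<and> path_image g = walk_image xs"
proof (induction xs)
  case (Cons x xs)
  then obtain y ys where xs: "xs = y # ys"
    by (cases xs) auto
  have gp: "gpath (y # ys)" and xy: "x \<in> V" "y \<in> V" "E x y" and x: "x \<notin> set (y # ys)"
    using Cons.prems(1) unfolding xs gpath_def by auto
  have gxy: "gpath [x, y]"
    using xy x unfolding gpath_def by auto
  have im_xy: "walk_image [x, y] = path_image (\<gamma> x y)"
    unfolding walk_image_def by simp
  show ?case
  proof (cases ys)
    case Nil
    then show ?thesis
      using edge_arc[OF xy] im_xy unfolding xs by auto
  next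
    case (Cons w ws)
    then obtain g where g: "arc g" "pathstart g = pos y" "pathfinish g = pos (last xs)"
      "path_image g = walk_image xs"
      using Cons.IH gp xs by fastforce
    have "path_image (\<gamma> x y) \<inter> walk_image xs \<subseteq> pos ` (set [x, y] \<inter> set xs)"
      unfolding im_xy[symmetric] using gxy gp x xs steps_subset[of xs]
      by (intro walk_images_meet) auto
    also have "\<dots> \<subseteq> {pos y}"
      using x xs by auto
    finally have "arc (\<gamma> x y +++ g)"
      using g edge_arc[OF xy] by (intro arc_join) auto
    moreover have "path_image (\<gamma> x y +++ g) = walk_image (x # xs)"
      using g edge_arc[OF xy] unfolding xs by (subst path_image_join) (auto simp: walk_image_def)
    ultimately show ?thesis
      using g edge_arc[OF xy] unfolding xs by (intro exI[of _ "\<gamma> x y +++ g"]) auto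
  qed
qed simp

text \<open>As soon as there is an inner vertex, no step joins the two ends. Hence parallel paths
  with disjoint inner vertices share no edge, even if one of them is just the edge from
  \<open>a\<close> to \<open>b\<close>.\<close>

lemma steps_between:
  assumes "distinct (a # P @ [b])" "P \<noteq> []"
  shows "steps (a # P @ [b]) \<inter> {a, b} \<times> {a, b} = {}"
proof -
  have "hd P \<in> set P" "last P \<in> set P"
    using assms(2) by auto
  then show ?thesis
    using assms steps_subset[of P] by (auto simp: steps_Cons steps_append)
qed

lemma parallel_walk_images_meet:
  assumes P: "gpath (a # P @ [b])" "P \<noteq> []" and Q: "gpath (a # Q @ [b])"
    and dis: "set P \<inter> set Q = {}"
  shows "walk_image (a # P @ [b]) \<inter> walk_image (a # Q @ [b]) = {pos a, pos b}"
proof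
  have common: "set (a # P @ [b]) \<inter> set (a # Q @ [b]) = {a, b}"
    using P Q dis unfolding gpath_def by auto
  have "steps (a # P @ [b]) \<inter> (steps (a # Q @ [b]) \<union> (steps (a # Q @ [b]))\<inverse>)
      \<subseteq> steps (a # P @ [b]) \<inter> {a, b} \<times> {a, b}"
    using steps_subset[of "a # P @ [b]"] steps_subset[of "a # Q @ [b]"] common by blast
  also have "\<dots> = {}"
    using P unfolding gpath_def by (intro steps_between) auto
  finally show "walk_image (a # P @ [b]) \<inter> walk_image (a # Q @ [b]) \<subseteq> {pos a, pos b}"
    using walk_images_meet[OF P(1) Q] common by auto
  show "{pos a, pos b} \<subseteq> walk_image (a # P @ [b]) \<inter> walk_image (a # Q @ [b])"
    using pos_in_walk_image[OF P(1)] pos_in_walk_image[OF Q] by auto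
qed

lemma theta_of_paths:
  assumes "gpath (a # P @ [b])" "gpath (a # Q @ [b])" "gpath (a # S @ [b])"
    and "set P \<inter> set Q = {}" "set P \<inter> set S = {}" "set Q \<inter> set S = {}" "P \<noteq> []" "Q \<noteq> []"
  obtains c1 c2 c3 where "theta c1 c2 c3 (pos a) (pos b)"
    "path_image c1 = walk_image (a # P @ [b])" "path_image c2 = walk_image (a # Q @ [b])"
    "path_image c3 = walk_image (a # S @ [b])"
proof -
  obtain c1 where c1: "arc c1" "pathstart c1 = pos a" "pathfinish c1 = pos b"
    "path_image c1 = walk_image (a # P @ [b])"
    using gpath_arc[OF assms(1)] by auto
  obtain c2 where c2: "arc c2" "pathstart c2 = pos a" "pathfinish c2 = pos b"
    "path_image c2 = walk_image (a # Q @ [b])"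
    using gpath_arc[OF assms(2)] by auto
  obtain c3 where c3: "arc c3" "pathstart c3 = pos a" "pathfinish c3 = pos b"
    "path_image c3 = walk_image (a # S @ [b])"
    using gpath_arc[OF assms(3)] by auto
  have "walk_image (a # P @ [b]) \<inter> walk_image (a # Q @ [b]) = {pos a, pos b}"
    "walk_image (a # P @ [b]) \<inter> walk_image (a # S @ [b]) = {pos a, pos b}"
    "walk_image (a # Q @ [b]) \<inter> walk_image (a # S @ [b]) = {pos a, pos b}"
    using assms by (intro parallel_walk_images_meet; simp)+
  then have "theta c1 c2 c3 (pos a) (pos b)"
    unfolding theta_def using c1 c2 c3 by auto
  then show thesis
    using that c1 c2 c3 by blast
qed

section \<open>Configurations excluded by the outer face\<close>

lemma inner_vertex_in_walk_image:
  assumes "gpath (a # P @ [b])" "v \<in> set P"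
  shows "pos v \<in> walk_image (a # P @ [b]) - {pos a, pos b}"
proof -
  have "a \<in> V" "b \<in> V" "v \<in> V" "v \<noteq> a" "v \<noteq> b"
    using assms unfolding gpath_def by auto
  then show ?thesis
    using pos_in_walk_image[OF assms(1)] assms(2) pos_inj by auto
qed

text \<open>This excludes subdivisions of K_{2,3}: one of the three arcs would lie inside the other
  two, together with a vertex.\<close>

lemma no_long_theta:
  assumes "gpath (a # P @ [b])" "gpath (a # Q @ [b])" "gpath (a # S @ [b])"
    and "set P \<inter> set Q = {}" "set P \<inter> set S = {}" "set Q \<inter> set S = {}"
    and "P \<noteq> []" "Q \<noteq> []" "S \<noteq> []"
  shows False
proof -
  obtain c1 c2 c3 where th: "theta c1 c2 c3 (pos a) (pos b)"
    and im: "path_image c1 = walk_image (a # P @ [b])" "path_image c2 = walk_image (a # Q @ [b])"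
      "path_image c3 = walk_image (a # S @ [b])"
    using theta_of_paths[OF assms(1-8)] .
  obtain u v w where uvw: "u \<in> set P" "v \<in> set Q" "w \<in> set S"
    using assms(7-9) by (meson hd_in_set)
  then have "u \<in> V" "v \<in> V" "w \<in> V"
    using assms(1-3) unfolding gpath_def by auto
  then show False
    using uvw outer assms(1-3) walk_image_subset_drawing unfolding im[symmetric]
    by (intro theta_not_all_outer[OF th, of "drawing_image V E pos \<gamma>" "pos u" "pos v" "pos w"])
      (use inner_vertex_in_walk_image im in auto)
qed

lemma chord_inside:
  assumes P: "gpath (a # P @ [b])" "P \<noteq> []" and Q: "gpath (a # Q @ [b])" "Q \<noteq> []"
    and dis: "set P \<inter> set Q = {}" and "E a b"
  obtains c1 c2 where "theta c1 c2 (\<gamma> a b) (pos a) (pos b)"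
    "path_image c1 = walk_image (a # P @ [b])" "path_image c2 = walk_image (a # Q @ [b])"
    "path_image (\<gamma> a b) - {pos a, pos b} \<subseteq> inside (path_image c1 \<union> path_image c2)"
proof -
  have ab: "a \<in> V" "b \<in> V" "a \<noteq> b"
    using P(1) unfolding gpath_def by auto
  then have chord: "gpath (a # [] @ [b])"
    using \<open>E a b\<close> unfolding gpath_def by auto
  obtain c1 c2 c3 where th: "theta c1 c2 c3 (pos a) (pos b)"
    and im: "path_image c1 = walk_image (a # P @ [b])" "path_image c2 = walk_image (a # Q @ [b])"
      "path_image c3 = walk_image (a # [] @ [b])"
    using theta_of_paths[OF P(1) Q(1) chord dis _ _ P(2) Q(2)] by auto
  have im3: "path_image c3 = path_image (\<gamma> a b)"
    unfolding im(3) walk_image_def by simp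
  have th': "theta c1 c2 (\<gamma> a b) (pos a) (pos b)"
    using th im3 edge_arc[OF ab(1,2) \<open>E a b\<close>] unfolding theta_def by auto
  obtain u v where uv: "u \<in> set P" "v \<in> set Q"
    using P(2) Q(2) by (meson hd_in_set)
  then have "u \<in> V" "v \<in> V"
    using P(1) Q(1) unfolding gpath_def by auto
  moreover have "pos u \<in> path_image c1 - {pos a, pos b}" "pos v \<in> path_image c2 - {pos a, pos b}"
    unfolding im using inner_vertex_in_walk_image P(1) Q(1) uv by auto
  moreover have "path_image c1 \<union> path_image c2 \<union> path_image (\<gamma> a b) \<subseteq> drawing_image V E pos \<gamma>"
    using walk_image_subset_drawing P(1) Q(1) chord unfolding im3[symmetric] im by auto
  ultimately have "path_image (\<gamma> a b) - {pos a, pos b} \<subseteq> inside (path_image c1 \<union> path_image c2)"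
    using outer by (intro theta_third_inside[OF th']) auto
  with that th' im show thesis by blast
qed

text \<open>The open edge is the connected set to which \<open>theta_chord_separates\<close> gets
  applied. Its ends lie on the cycle and not inside it, so they are reached only as limit
  points.\<close>

lemma edge_ends_in_closure:
  assumes "u \<in> V" "v \<in> V" "E u v"
  shows "{pos u, pos v} \<subseteq> closure (path_image (\<gamma> u v) - {pos u, pos v})"
proof -
  let ?g = "\<gamma> u v"
  have eq: "path_image ?g - {pos u, pos v} = ?g ` {0<..<1}"
    using simple_path_endless[OF arc_imp_simple_path] edge_arc[OF assms] by metis
  have "continuous_on {0..1} ?g"
    using edge_arc(1)[OF assms] arc_imp_path path_def by blast
  then have "?g ` closure {0<..<1} \<subseteq> closure (?g ` {0<..<1})"
    by (intro image_closure_subset) (auto simp: closure_subset)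
  moreover have "pos u = ?g 0" "pos v = ?g 1"
    using edge_arc(2,3)[OF assms] unfolding pathstart_def pathfinish_def by auto
  ultimately show ?thesis
    unfolding eq by auto
qed

text \<open>Both chords lie inside the closed curve drawn by the cycle through \<open>P\<close> and
  \<open>Q\<close>. There the chord from \<open>a\<close> to \<open>b\<close> separates
  \<open>c\<close> from \<open>d\<close>, but the open edge from \<open>c\<close> to
  \<open>d\<close> is a connected set that approaches both without meeting that chord.\<close>

lemma no_crossing_chords:
  assumes P: "gpath (a # P @ [b])" and Q: "gpath (a # Q @ [b])" and dis: "set P \<inter> set Q = {}"
    and ab: "E a b" and c: "c \<in> set P" and d: "d \<in> set Q" and cd: "E c d"
  shows False
proof -
  obtain P1 P2 where P12: "P = P1 @ c # P2"
    using split_list[OF c] by blast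
  obtain Q1 Q2 where Q12: "Q = Q1 @ d # Q2"
    using split_list[OF d] by blast
  \<comment> \<open>The same cycle seen from \<open>c\<close> and \<open>d\<close>:
    \<open>?S\<close> is its arc through \<open>b\<close>, \<open>?T\<close> its arc through
    \<open>a\<close>.\<close>
  let ?S = "P2 @ b # rev Q2" and ?T = "rev P1 @ a # Q1"
  let ?U1 = "steps (a # P1 @ [c])" and ?U2 = "steps (c # P2 @ [b])"
    and ?W1 = "steps (a # Q1 @ [d])" and ?W2 = "steps (d # Q2 @ [b])"
  have steps_P: "steps (a # P @ [b]) = ?U1 \<union> ?U2"
    using steps_split[of "a # P1" c "P2 @ [b]"] unfolding P12 by simp
  have steps_Q: "steps (a # Q @ [b]) = ?W1 \<union> ?W2"
    using steps_split[of "a # Q1" d "Q2 @ [b]"] unfolding Q12 by simp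
  have steps_S: "steps (c # ?S @ [d]) = ?U2 \<union> ?W2\<inverse>"
    using steps_split[of "c # P2" b "rev Q2 @ [d]"] steps_rev[of "d # Q2 @ [b]"] by simp
  have steps_T: "steps (c # ?T @ [d]) = ?U1\<inverse> \<union> ?W1"
    using steps_split[of "c # rev P1" a "Q1 @ [d]"] steps_rev[of "a # P1 @ [c]"] by simp
  have E_steps: "E u v" if "(u, v) \<in> ?U1 \<union> ?U2 \<union> ?W1 \<union> ?W2" for u v
    using that gpath_steps(3)[OF P] gpath_steps(3)[OF Q] steps_P steps_Q by blast
  have S: "gpath (c # ?S @ [d])"
    unfolding gpath_def steps_S
    using P Q dis E_steps E_sym unfolding P12 Q12 gpath_def by auto
  have T: "gpath (c # ?T @ [d])"
    unfolding gpath_def steps_T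
    using P Q dis E_steps E_sym unfolding P12 Q12 gpath_def by auto
  have ST: "set ?S \<inter> set ?T = {}"
    using P Q dis unfolding P12 Q12 gpath_def by auto
  have verts: "a \<in> V" "b \<in> V" "c \<in> V" "d \<in> V" "{a, b} \<inter> {c, d} = {}"
    using P Q c d unfolding gpath_def by auto
  have rev_edge: "path_image (\<gamma> v u) = path_image (\<gamma> u v)"
    if "(u, v) \<in> ?U1 \<union> ?U2 \<union> ?W1 \<union> ?W2" for u v
    using that gpath_steps[OF P] gpath_steps[OF Q] edge_arc(4)[of u v] steps_P steps_Q
      path_image_reversepath by (metis UnE UnI1 UnI2)
  have rev_image: "(\<Union>(u, v)\<in>S\<inverse>. path_image (\<gamma> u v)) = (\<Union>(u, v)\<in>S. path_image (\<gamma> u v))"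
    if "S \<subseteq> ?U1 \<union> ?U2 \<union> ?W1 \<union> ?W2" for S
  proof -
    have "path_image (\<gamma> v u) = path_image (\<gamma> u v)" if "(u, v) \<in> S" for u v
      using rev_edge that \<open>S \<subseteq> _\<close> by blast
    then show ?thesis by fast
  qed
  have rev_U1: "(\<Union>(u, v)\<in>?U1\<inverse>. path_image (\<gamma> u v)) = (\<Union>(u, v)\<in>?U1. path_image (\<gamma> u v))"
    by (rule rev_image) blast
  have rev_W2: "(\<Union>(u, v)\<in>?W2\<inverse>. path_image (\<gamma> u v)) = (\<Union>(u, v)\<in>?W2. path_image (\<gamma> u v))"
    by (rule rev_image) blast
  have same_image: "walk_image (c # ?S @ [d]) \<union> walk_image (c # ?T @ [d])
      = walk_image (a # P @ [b]) \<union> walk_image (a # Q @ [b])"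
    unfolding walk_image_def steps_P steps_Q steps_S steps_T UN_Un rev_U1 rev_W2 by blast
  obtain c1 c2 where th: "theta c1 c2 (\<gamma> a b) (pos a) (pos b)"
    and im: "path_image c1 = walk_image (a # P @ [b])" "path_image c2 = walk_image (a # Q @ [b])"
    and ins: "path_image (\<gamma> a b) - {pos a, pos b} \<subseteq> inside (path_image c1 \<union> path_image c2)"
    using chord_inside[OF P _ Q _ dis ab] c d by (metis empty_iff list.set(1))
  obtain c1' c2' where th': "theta c1' c2' (\<gamma> c d) (pos c) (pos d)"
    and im': "path_image c1' = walk_image (c # ?S @ [d])" "path_image c2' = walk_image (c # ?T @ [d])"
    and ins': "path_image (\<gamma> c d) - {pos c, pos d} \<subseteq> inside (path_image c1' \<union> path_image c2')"
    using chord_inside[OF S _ T _ ST cd] by auto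
  \<comment> \<open>Both theta curves consist of the same cycle and one chord, so both chords lie in
    the same inside.\<close>
  have J: "path_image c1' \<union> path_image c2' = path_image c1 \<union> path_image c2"
    using same_image unfolding im im' by blast
  have "path_image (\<gamma> c d) \<inter> path_image (\<gamma> a b) = {}"
    using edges_meet[of c d a b] verts ab cd by auto
  moreover have "connected (path_image (\<gamma> c d) - {pos c, pos d})"
    by (rule theta_endless_connected[OF th'])
  ultimately show False
    using theta_chord_separates[OF th ins, of "path_image (\<gamma> c d) - {pos c, pos d}" "pos c" "pos d"]
      ins' J edge_ends_in_closure[OF verts(3,4) cd]
      inner_vertex_in_walk_image[OF P c] inner_vertex_in_walk_image[OF Q d]
    unfolding im by auto
qed

end

section \<open>Noncrossing vertex orders\<close>

text \<open>A one-page book embedding. Positions are natural numbers with gaps allowed, which makes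
  it easy to insert one order into another.\<close>

definition noncrossing :: "'a set \<Rightarrow> ('a \<Rightarrow> 'a \<Rightarrow> bool) \<Rightarrow> ('a \<Rightarrow> nat) \<Rightarrow> bool" where
  "noncrossing S E f \<longleftrightarrow> inj_on f S \<and>
     (\<forall>u\<in>S. \<forall>x\<in>S. \<forall>v\<in>S. \<forall>y\<in>S. f u < f x \<longrightarrow> f x < f v \<longrightarrow> f v < f y \<longrightarrow> E u v \<longrightarrow> \<not> E x y)"

text \<open>The order of the second part is inserted into the first one directly after the cut vertex c.\<close>

lemma noncrossing_glue:
  assumes f1: "noncrossing S1 E f1" and f2: "noncrossing S2 E f2" and "finite S2"
    and cap: "S1 \<inter> S2 = {c}" and c0: "f2 c = 0" and r: "r \<in> S1" "f1 r = 0"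
    and sep: "\<And>u v. u \<in> S1 - {c} \<Longrightarrow> v \<in> S2 - {c} \<Longrightarrow> \<not> E u v \<and> \<not> E v u"
  shows "\<exists>f. noncrossing (S1 \<union> S2) E f \<and> f r = 0"
proof -
  obtain M where M: "\<And>y. y \<in> S2 \<Longrightarrow> f2 y < M"
    using finite_nat_set_iff_bounded[of "f2 ` S2"] \<open>finite S2\<close> by auto
  \<comment> \<open>Scaling by \<open>M\<close> leaves room for all of \<open>S2\<close> between
    \<open>c\<close> and the next vertex of \<open>S1\<close>. As \<open>f2 c = 0\<close>, the two
    formulas agree at \<open>c\<close>.\<close>
  define f where "f v = (if v \<in> S1 then f1 v * M else f1 c * M + f2 v)" for v
  have c: "c \<in> S1" "c \<in> S2" using cap by auto
  then have "M > 0" using M[of c] by simp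
  have fS1: "f v = f1 v * M" if "v \<in> S1" for v
    using that unfolding f_def by simp
  have fS2: "f v = f1 c * M + f2 v" if "v \<in> S2" for v
  proof (cases "v \<in> S1")
    case True
    then have "v = c" using that cap by auto
    then show ?thesis using c0 c unfolding f_def by simp
  qed (simp add: f_def)
  have lt1: "f u < f v \<longleftrightarrow> f1 u < f1 v" if "u \<in> S1" "v \<in> S1" for u v
    using that fS1 \<open>M > 0\<close> by simp
  have lt2: "f u < f v \<longleftrightarrow> f2 u < f2 v" if "u \<in> S2" "v \<in> S2" for u v
    using that fS2 by simp
  have c_least: "f c \<le> f u" if "u \<in> S2" for u
    using fS2[OF that] fS2[OF c(2)] c0 by simp
  \<comment> \<open>Two crossing edges from different parts would put a vertex of \<open>S1\<close>
    strictly between two vertices of \<open>S2\<close>. That vertex could only be \<open>c\<close>,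
    but \<open>c\<close> comes first in \<open>S2\<close>.\<close>
  have block: "v = c" if "v \<in> S1" "u \<in> S2" "w \<in> S2" "f u \<le> f v" "f v \<le> f w" for u v w
  proof -
    have "f1 c * M \<le> f1 v * M" "f1 v * M < f1 c * M + M"
      using that(4,5) fS1[OF that(1)] fS2[OF that(2)] fS2[OF that(3)] M[OF that(3)] by linarith+
    then have "f1 c * M \<le> f1 v * M" "f1 v * M < Suc (f1 c) * M"
      by auto
    then have "f1 c \<le> f1 v" "f1 v < Suc (f1 c)"
      unfolding mult_le_cancel2 mult_less_cancel2 using \<open>M > 0\<close> by auto
    then have "f1 v = f1 c" by simp
    then show ?thesis
      using f1 \<open>v \<in> S1\<close> c unfolding noncrossing_def inj_on_def by blast
  qed
  have inj1: "u = v" if "u \<in> S1" "v \<in> S1" "f u = f v" for u v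
    using that f1 fS1 \<open>M > 0\<close> unfolding noncrossing_def inj_on_def by auto
  have inj2: "u = v" if "u \<in> S2" "v \<in> S2" "f u = f v" for u v
    using that f2 fS2 unfolding noncrossing_def inj_on_def by auto
  have inj12: "u = v" if "u \<in> S1" "v \<in> S2" "f u = f v" for u v
    using that block[of u v v] inj2[of u v] c by auto
  have "inj_on f (S1 \<union> S2)"
    unfolding inj_on_def using inj1 inj2 inj12 by (metis Un_iff)
  moreover have False
    if in_S: "u \<in> S1 \<union> S2" "x \<in> S1 \<union> S2" "v \<in> S1 \<union> S2" "y \<in> S1 \<union> S2"
      and less: "f u < f x" "f x < f v" "f v < f y" and E: "E u v" "E x y" for u x v y
  proof -
    have "u \<in> S1 \<and> v \<in> S1 \<or> u \<in> S2 \<and> v \<in> S2"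
      using in_S(1,3) E(1) sep c by blast
    moreover have "x \<in> S1 \<and> y \<in> S1 \<or> x \<in> S2 \<and> y \<in> S2"
      using in_S(2,4) E(2) sep c by blast
    ultimately consider "u \<in> S1" "v \<in> S1" "x \<in> S1" "y \<in> S1" | "u \<in> S2" "v \<in> S2" "x \<in> S2" "y \<in> S2"
      | "u \<in> S1" "v \<in> S1" "x \<in> S2" "y \<in> S2" | "u \<in> S2" "v \<in> S2" "x \<in> S1" "y \<in> S1"
      by blast
    then show False
    proof cases
      case 1
      then show False using f1 lt1 less E unfolding noncrossing_def by blast
    next
      case 2
      then show False using f2 lt2 less E unfolding noncrossing_def by blast
    next
      case 3
      then show False using block[of v x y] c_least[of x] less by auto
    next
      case 4
      then show False using block[of x u v] c_least[of u] less by auto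
    qed
  qed
  ultimately have "noncrossing (S1 \<union> S2) E f"
    unfolding noncrossing_def by blast
  then show ?thesis
    using fS1[OF r(1)] r(2) by auto
qed

text \<open>A crossing involves four distinct vertices, so any order that starts at \<open>r\<close>
  will do.\<close>

lemma noncrossing_small:
  assumes "finite S" "card S \<le> 3" "r \<in> S"
  shows "\<exists>f. noncrossing S E f \<and> f r = 0"
proof -
  obtain g :: "'a \<Rightarrow> nat" where g: "inj_on g S"
    using finite_imp_inj_to_nat_seg[OF assms(1)] by blast
  define f where "f v = (if v = r then 0 else Suc (g v))" for v
  have "inj_on f S"
    using g unfolding inj_on_def f_def by auto
  moreover have False if "u \<in> S" "x \<in> S" "v \<in> S" "y \<in> S" "f u < f x" "f x < f v" "f v < f y" for u x v y
  proof -
    have "card {u, x, v, y} = 4"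
      using that(5-7) by (auto simp: card_insert_if)
    moreover have "{u, x, v, y} \<subseteq> S"
      using that by auto
    ultimately show False
      using card_mono[OF assms(1), of "{u, x, v, y}"] assms(2) by simp
  qed
  ultimately have "noncrossing S E f"
    unfolding noncrossing_def by blast
  then show ?thesis
    unfolding f_def by auto
qed

section \<open>Cycles and the order along a Hamiltonian cycle\<close>

context outerplanar_drawing
begin

text \<open>A single edge \<open>[u, v]\<close> counts as a cycle of length 2; the search for a
  longest cycle starts from one.\<close>

definition gcycle :: "'a list \<Rightarrow> bool" where
  "gcycle xs \<longleftrightarrow> gpath xs \<and> xs \<noteq> [] \<and> E (last xs) (hd xs)"

lemma gcycle_rotate:
  assumes "gcycle (xs @ ys)"
  shows "gcycle (ys @ xs)"
proof (cases "xs = [] \<or> ys = []")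
  case False
  then show ?thesis
    using assms unfolding gcycle_def gpath_def by (auto simp: steps_append hd_append)
qed (use assms in auto)

lemma gcycle_split:
  assumes "gcycle (a # P @ b # Q)"
  shows "gpath (a # P @ [b])" "gpath (a # rev Q @ [b])" "set P \<inter> set Q = {}"
proof -
  have E: "E (last (b # Q)) a" and gp: "gpath (a # P @ b # Q)"
    using assms unfolding gcycle_def by auto
  show "gpath (a # P @ [b])"
    using gp steps_split[of "a # P" b Q] unfolding gpath_def by auto
  have "gpath (b # Q @ [a])"
    using gp steps_split[of "a # P" b Q] E steps_append[of "b # Q" "[a]"] unfolding gpath_def by auto
  then show "gpath (a # rev Q @ [b])"
    using gpath_rev[of "b # Q @ [a]"] by simp
  show "set P \<inter> set Q = {}"
    using gp unfolding gpath_def by auto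
qed

text \<open>Positions along the cycle work: if \<open>a\<close>, \<open>c\<close>, \<open>b\<close>,
  \<open>d\<close> occur in this order, then \<open>c\<close> and \<open>d\<close> lie on different
  arcs between \<open>a\<close> and \<open>b\<close>, where \<open>no_crossing_chords\<close>
  applies.\<close>

lemma noncrossing_gcycle:
  assumes "gcycle (r # xs)" "set (r # xs) = S"
  shows "\<exists>f. noncrossing S E f \<and> f r = 0"
proof -
  let ?xs = "r # xs"
  have dist: "distinct ?xs"
    using assms(1) unfolding gcycle_def gpath_def by simp
  define f where "f = the_inv_into {..<length ?xs} (\<lambda>i. ?xs ! i)"
  have f: "f (?xs ! i) = i" if "i < length ?xs" for i
    unfolding f_def using that dist inj_on_nth[OF dist, of "{..<length ?xs}"]
    by (intro the_inv_into_f_f) auto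
  have index: "\<exists>i<length ?xs. v = ?xs ! i \<and> f v = i" if "v \<in> S" for v
    using that f unfolding assms(2)[symmetric] by (metis in_set_conv_nth)
  have "inj_on f S"
    using index unfolding inj_on_def by metis
  moreover have False
    if in_S: "a \<in> S" "c \<in> S" "b \<in> S" "d \<in> S"
      and less: "f a < f c" "f c < f b" "f b < f d" and E: "E a b" "E c d" for a c b d
  proof -
    have ix: "?xs ! f a = a" "?xs ! f b = b" "?xs ! f c = c" "?xs ! f d = d"
      "f a < length ?xs" "f b < length ?xs" "f d < length ?xs"
      using index in_S by metis+
    \<comment> \<open>The list is cut at \<open>a\<close> and \<open>b\<close>. After rotation to
      start at \<open>a\<close>, the arcs between them are \<open>P\<close>, containing
      \<open>c\<close>, and \<open>B @ A\<close>, containing \<open>d\<close>.\<close>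
    define A where "A = take (f a) ?xs"
    define P where "P = drop (Suc (f a)) (take (f b) ?xs)"
    define B where "B = drop (Suc (f b)) ?xs"
    have "take (f b) ?xs = A @ a # P"
      using id_take_nth_drop[of "f a" "take (f b) ?xs"] ix less unfolding A_def P_def
      by (simp add: min_def)
    moreover have "?xs = take (f b) ?xs @ b # B"
      using id_take_nth_drop[of "f b" ?xs] ix(2,6) unfolding B_def by metis
    ultimately have split: "?xs = A @ a # P @ b # B"
      by (metis append.assoc append_Cons)
    have "P ! (f c - Suc (f a)) = c" "f c - Suc (f a) < length P"
      unfolding P_def using ix less by (auto simp del: drop_Suc_Cons take_Suc_Cons)
    then have c: "c \<in> set P"
      using nth_mem by metis
    have "B ! (f d - Suc (f b)) = d" "f d - Suc (f b) < length B"
      unfolding B_def using ix less by (auto simp del: drop_Suc_Cons take_Suc_Cons)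
    then have d: "d \<in> set B"
      using nth_mem by metis
    have "gcycle (a # P @ b # (B @ A))"
      using gcycle_rotate[of A "a # P @ b # B"] assms(1) split by simp
    from gcycle_split[OF this] show False
      using no_crossing_chords[of a P b "rev (B @ A)" c d] c d E by auto
  qed
  ultimately have "noncrossing S E f"
    unfolding noncrossing_def by blast
  moreover have "f r = 0"
    using f[of 0] by simp
  ultimately show ?thesis by blast
qed

section \<open>Ears and longest cycles\<close>

lemma reachable_gpath:
  assumes "(x, y) \<in> (edge_rel T E)\<^sup>*" "x \<in> T" "T \<subseteq> V"
  shows "\<exists>ws. gpath ws \<and> set ws \<subseteq> T \<and> ws \<noteq> [] \<and> hd ws = x \<and> last ws = y"
  using assms(1)
proof induction
  case base
  then show ?case
    using assms by (intro exI[of _ "[x]"]) (auto simp: gpath_def)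
next
  case (step y z)
  then obtain ws where ws: "gpath ws" "set ws \<subseteq> T" "ws \<noteq> []" "hd ws = x" "last ws = y"
    by blast
  have z: "z \<in> T" "E y z"
    using step.hyps unfolding edge_rel_def by auto
  show ?case
  proof (cases "z \<in> set ws")
    case True
    then obtain A B where AB: "ws = A @ z # B"
      by (meson split_list)
    then have "gpath (A @ [z])" "hd (A @ [z]) = x"
      using ws steps_split[of A z B] unfolding gpath_def by (auto simp: hd_append split: if_splits)
    then show ?thesis
      using ws AB by (intro exI[of _ "A @ [z]"]) auto
  next
    case False
    then have "gpath (ws @ [z])"
      using ws z assms(3) unfolding gpath_def by (auto simp: steps_append)
    then show ?thesis
      using ws z by (intro exI[of _ "ws @ [z]"]) auto
  qed
qed

text \<open>If \<open>u\<close> and \<open>v\<close> are neighbours on the cycle, the ear replaces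
  the edge between them and lengthens the cycle. Otherwise the ear and the two arcs of the cycle are
  three parallel paths with inner vertices, which \<open>no_long_theta\<close> rules out.\<close>

lemma gcycle_extend:
  assumes cyc: "gcycle xs" and u: "u \<in> set xs" and v: "v \<in> set xs" and "u \<noteq> v"
    and ws: "gpath ws" "ws \<noteq> []" "set ws \<inter> set xs = {}" and E: "E u (hd ws)" "E (last ws) v"
  shows "\<exists>ys. gcycle ys \<and> set ys \<subseteq> set xs \<union> set ws \<and> length xs < length ys"
proof -
  obtain A B where AB: "xs = A @ u # B"
    using split_list[OF u] by blast
  then have "v \<in> set (B @ A)"
    using v \<open>u \<noteq> v\<close> by auto
  then obtain P Q where PQ: "B @ A = P @ v # Q"
    by (meson split_list)
  have cyc': "gcycle (u # P @ v # Q)"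
    using gcycle_rotate[of A "u # B"] cyc AB PQ by simp
  have set_xs: "set xs = set (u # P @ v # Q)"
    using arg_cong[OF PQ, of set] AB by auto
  have len: "length xs = length (u # P @ v # Q)"
    using arg_cong[OF PQ, of length] AB by auto
  note split = gcycle_split[OF cyc']
  have ear: "gpath (u # ws @ [v])"
    using ws E split(1) set_xs unfolding gpath_def by (auto simp: steps_append steps_Cons)
  consider "P = []" | "Q = []" | "P \<noteq> []" "Q \<noteq> []" by blast
  then show ?thesis
  proof cases
    case 1
    then have "gcycle (u # ws @ v # Q)"
      using ear cyc' ws(3) steps_split[of "u # ws" v Q] unfolding set_xs gcycle_def gpath_def
      by (auto simp: steps_Cons)
    then show ?thesis
      using 1 len ws(2) set_xs by (intro exI[of _ "u # ws @ v # Q"]) auto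
  next
    case 2
    \<comment> \<open>Here \<open>v\<close> is the last vertex and \<open>u\<close> the first, so
      the ear replaces the closing edge and is traversed backwards.\<close>
    have "gpath (v # rev ws @ [u])"
      using ear gpath_rev[of "u # ws @ [v]"] by simp
    then have "gpath (v # rev ws)" "E (last (v # rev ws)) u"
      using ws(2) unfolding gpath_def by (auto simp: steps_append steps_Cons split: if_splits)
    then have "gcycle (u # P @ v # rev ws)"
      using 2 cyc' ws(3) steps_split[of "u # P" v "rev ws"] unfolding set_xs gcycle_def gpath_def
      by auto
    then show ?thesis
      using 2 len ws(2) set_xs by (intro exI[of _ "u # P @ v # rev ws"]) auto
  next
    case 3
    then have False
      using no_long_theta[OF split(1,2) ear] split(3) ws(2,3) set_xs by auto
    then show ?thesis ..
  qed
qed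

text \<open>Take a longest cycle. A component of the remaining vertices has at least two attachment
  vertices on it, since a single one would be a separating vertex; a path through the component then
  is an ear, and \<open>gcycle_extend\<close> gives a longer cycle.\<close>

lemma Hamiltonian_gcycle:
  assumes "S \<subseteq> V" "card S \<ge> 3"
    and nosep: "\<And>c A. c \<in> S \<Longrightarrow> A \<noteq> {} \<Longrightarrow> A \<subseteq> S - {c} \<Longrightarrow> S - {c} - A \<noteq> {} \<Longrightarrow>
       \<exists>u\<in>A. \<exists>v\<in>S - {c} - A. E u v"
  shows "\<exists>xs. gcycle xs \<and> set xs = S"
proof -
  have "finite S"
    using assms(1) finite_V finite_subset by blast
  define C where "C xs \<longleftrightarrow> gcycle xs \<and> set xs \<subseteq> S \<and> length xs \<ge> 2" for xs
  have bounded: "length xs < Suc (card S)" if "C xs" for xs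
    using that card_mono[OF \<open>finite S\<close>, of "set xs"] distinct_card[of xs]
    unfolding C_def gcycle_def gpath_def by auto
  obtain T where T: "T \<subseteq> S" "card T = 3"
    by (rule obtain_subset_with_card_n[OF assms(2)])
  then obtain c a b where abc: "T = {c, a, b}" "c \<noteq> a" "a \<noteq> b" "c \<noteq> b"
    using card_3_iff[of T] by auto
  \<comment> \<open>Removing \<open>c\<close> does not isolate \<open>a\<close>, which provides an
    edge \<open>[a, v]\<close> as a first cycle.\<close>
  have "\<exists>u\<in>{a}. \<exists>v\<in>S - {c} - {a}. E u v"
  proof (rule nosep)
    show "{a} \<subseteq> S - {c}"
      using T(1) abc(1,2) by simp
    show "S - {c} - {a} \<noteq> {}"
      using T(1) abc by (metis Diff_iff empty_iff insert_subset singletonD)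
    show "c \<in> S"
      using T(1) abc(1) by simp
  qed simp
  then obtain v where v: "v \<in> S" "v \<noteq> a" "E a v"
    by auto
  then have "C [a, v]"
    using T(1) abc(1) assms(1) E_sym[OF v(3)] unfolding C_def gcycle_def gpath_def by auto
  then obtain xs where xs: "C xs" and max: "\<And>ys. C ys \<Longrightarrow> length ys \<le> length xs"
    using ex_has_greatest_nat[of C "[a, v]" length "Suc (card S)"] bounded by auto
  have "set xs = S"
  proof (rule ccontr)
    let ?T = "S - set xs"
    assume "set xs \<noteq> S"
    then obtain w where w: "w \<in> ?T"
      using xs unfolding C_def by blast
    \<comment> \<open>\<open>W\<close> is the component of \<open>w\<close> off the cycle,
      \<open>N\<close> the set of its neighbours on the cycle.\<close>
    define W where "W = {y. (w, y) \<in> (edge_rel ?T E)\<^sup>*}"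
    define N where "N = {u \<in> set xs. \<exists>x\<in>W. E u x}"
    have W: "W \<subseteq> ?T"
    proof
      fix y assume "y \<in> W"
      then have "(w, y) \<in> (edge_rel ?T E)\<^sup>*" unfolding W_def by simp
      then show "y \<in> ?T"
        by cases (use w in \<open>auto simp: edge_rel_def\<close>)
    qed
    \<comment> \<open>The cycle has a vertex other than \<open>c\<close>, so \<open>W\<close> is not
      all of \<open>S - {c}\<close> and some edge leaves \<open>W\<close> there. Its far end lies on
      the cycle, because \<open>W\<close> is a whole component of the rest.\<close>
    have attach: "\<exists>u\<in>N. u \<noteq> c" if c: "c \<in> set xs" for c
    proof -
      have "card (set xs) \<ge> 2"
        using xs distinct_card unfolding C_def gcycle_def gpath_def by fastforce
      then have "set xs \<noteq> {c}" by auto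
      then obtain c' where "c' \<in> set xs" "c' \<noteq> c"
        using c by blast
      then have "c' \<in> S - {c} - W"
        using W xs unfolding C_def by blast
      then have "S - {c} - W \<noteq> {}" by blast
      moreover have "W \<subseteq> S - {c}"
        using W c by blast
      moreover have "W \<noteq> {}"
        unfolding W_def by auto
      moreover have "c \<in> S"
        using xs c unfolding C_def by blast
      ultimately obtain x v where xv: "x \<in> W" "v \<in> S - {c} - W" "E x v"
        using nosep[of c W] by blast
      have "v \<in> set xs"
      proof (rule ccontr)
        assume "v \<notin> set xs"
        then have "(x, v) \<in> edge_rel ?T E"
          using xv W unfolding edge_rel_def by auto
        then have "v \<in> W"
          using xv(1) unfolding W_def by auto
        with xv show False by blast
      qed
      then show ?thesis
        using xv E_sym unfolding N_def by blast
    qed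
    obtain u where u: "u \<in> N"
      using attach[of "hd xs"] xs unfolding C_def gcycle_def by auto
    obtain v where v: "v \<in> N" "v \<noteq> u"
      using attach[of u] u unfolding N_def by blast
    obtain x y where xy: "x \<in> W" "E u x" "y \<in> W" "E v y"
      using u v unfolding N_def by blast
    have "sym ((edge_rel ?T E)\<^sup>*)"
      by (intro sym_rtrancl) (auto simp: sym_def edge_rel_def E_sym)
    then have "(x, y) \<in> (edge_rel ?T E)\<^sup>*"
      using xy unfolding W_def by (metis mem_Collect_eq rtrancl_trans symD)
    moreover have "x \<in> ?T"
      using xy W by blast
    ultimately obtain ws where ws: "gpath ws" "set ws \<subseteq> ?T" "ws \<noteq> []" "hd ws = x" "last ws = y"
      using reachable_gpath[of x y ?T] assms(1) by blast
    obtain ys where "gcycle ys" "set ys \<subseteq> set xs \<union> set ws" "length xs < length ys"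
      using gcycle_extend[of xs u v ws] xs u v ws xy E_sym unfolding C_def N_def by blast
    then show False
      using max[of ys] xs ws(2) unfolding C_def by auto
  qed
  then show ?thesis
    using xs unfolding C_def by blast
qed

text \<open>The induction runs over vertex subsets in the fixed drawing. The vertex \<open>r\<close>
  has to be arbitrary, because the part away from \<open>r\<close> is ordered starting at
  \<open>c\<close>. The separating case also absorbs disconnected sets \<open>S\<close>.\<close>

lemma exists_noncrossing:
  "S \<subseteq> V \<Longrightarrow> r \<in> S \<Longrightarrow> \<exists>f. noncrossing S E f \<and> f r = 0"
proof (induction "card S" arbitrary: S r rule: less_induct)
  case less
  have fin: "finite S"
    using less.prems(1) finite_V finite_subset by blast
  show ?case
  proof (cases "card S \<le> 3")
    case True
    then show ?thesis
      using noncrossing_small[OF fin _ less.prems(2)] by blast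
  next
    case large: False
    show ?thesis
    proof (cases "\<exists>c\<in>S. \<exists>A. A \<noteq> {} \<and> A \<subseteq> S - {c} \<and> S - {c} - A \<noteq> {} \<and>
        (\<forall>u\<in>A. \<forall>v\<in>S - {c} - A. \<not> E u v)")
      case True
      then obtain c where "c \<in> S" "\<exists>A. A \<noteq> {} \<and> A \<subseteq> S - {c} \<and> S - {c} - A \<noteq> {} \<and>
          (\<forall>u\<in>A. \<forall>v\<in>S - {c} - A. \<not> E u v)"
        by (rule bexE)
      then obtain A where A: "c \<in> S" "A \<noteq> {} \<and> A \<subseteq> S - {c} \<and> S - {c} - A \<noteq> {} \<and>
          (\<forall>u\<in>A. \<forall>v\<in>S - {c} - A. \<not> E u v)"
        by (elim exE)
      then have cA: "c \<in> S" "A \<noteq> {}" "A \<subseteq> S - {c}" "S - {c} - A \<noteq> {}"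
        by simp_all
      have sep: "\<not> E u v" if "u \<in> A" "v \<in> S - {c} - A" for u v
        using A(2) that by blast
      have sep_sym: "\<not> E u v" if "u \<in> S - {c} - A" "v \<in> A" for u v
        using sep[OF that(2,1)] E_sym by blast
      have glue: ?thesis
        if S: "S1 \<union> S2 = S" "S1 \<inter> S2 = {c}" "S1 \<noteq> S" "S2 \<noteq> S" and r: "r \<in> S1"
          and sep': "\<And>u v. u \<in> S1 - {c} \<Longrightarrow> v \<in> S2 - {c} \<Longrightarrow> \<not> E u v" for S1 S2
      proof -
        have sub: "S1 \<subseteq> S" "S2 \<subseteq> S" "c \<in> S2"
          using S(1,2) by auto
        have "card S1 < card S" "card S2 < card S"
          using sub S(3,4) by (auto intro!: psubset_card_mono[OF fin])
        moreover have "S1 \<subseteq> V" "S2 \<subseteq> V"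
          using sub less.prems(1) by auto
        ultimately obtain f1 f2 where f: "noncrossing S1 E f1" "f1 r = 0" "noncrossing S2 E f2" "f2 c = 0"
          using less.hyps[of S1 r] less.hyps[of S2 c] r sub(3) by metis
        have "\<exists>f. noncrossing (S1 \<union> S2) E f \<and> f r = 0"
          using sep' E_sym sub(2) fin finite_subset
          by (intro noncrossing_glue[OF f(1,3) _ S(2) f(4) r f(2)]) blast+
        then show ?thesis
          unfolding S(1) .
      qed
      show ?thesis
      proof (cases "r \<in> insert c A")
        case True
        show ?thesis
          by (rule glue[of "insert c A" "S - A"]) (use cA sep True in auto)
      next
        case False
        show ?thesis
          by (rule glue[of "S - A" "insert c A"]) (use cA sep_sym False less.prems(2) in auto)
      qed
    next
      case False
      have nosep: "\<exists>u\<in>A. \<exists>v\<in>S - {c} - A. E u v"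
        if "c \<in> S" "A \<noteq> {}" "A \<subseteq> S - {c}" "S - {c} - A \<noteq> {}" for c A
      proof (rule ccontr)
        assume "\<not> ?thesis"
        then have "\<forall>u\<in>A. \<forall>v\<in>S - {c} - A. \<not> E u v"
          by simp
        with that(2-4) have "\<exists>A. A \<noteq> {} \<and> A \<subseteq> S - {c} \<and> S - {c} - A \<noteq> {} \<and>
            (\<forall>u\<in>A. \<forall>v\<in>S - {c} - A. \<not> E u v)"
          by (intro exI conjI)
        with that(1) have "\<exists>c\<in>S. \<exists>A. A \<noteq> {} \<and> A \<subseteq> S - {c} \<and> S - {c} - A \<noteq> {} \<and>
            (\<forall>u\<in>A. \<forall>v\<in>S - {c} - A. \<not> E u v)"
          by (rule bexI[rotated])
        with False show False ..
      qed
      have "\<exists>xs. gcycle xs \<and> set xs = S"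
        using large by (intro Hamiltonian_gcycle less.prems(1) nosep) simp_all
      then obtain xs where xs: "gcycle xs" "set xs = S"
        by blast
      then obtain A B where AB: "xs = A @ r # B"
        using less.prems(2) by (metis split_list)
      then have "gcycle (r # B @ A)"
        using gcycle_rotate[of A "r # B"] xs by simp
      then show ?thesis
        by (rule noncrossing_gcycle) (use xs AB in auto)
    qed
  qed
qed

end

section \<open>Distances along a layer\<close>

locale connected_simple_graph =
  fixes V :: "'a set" and E :: "'a \<Rightarrow> 'a \<Rightarrow> bool"
  assumes simple: "simple_graph V E" and connected: "connected_graph V E"
begin

abbreviation dist\<^sub>G :: "'a \<Rightarrow> 'a \<Rightarrow> nat" where
  "dist\<^sub>G \<equiv> gdist V E"

lemma E_sym: "E u v \<Longrightarrow> E v u"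
  using simple unfolding simple_graph_def by auto

lemma gdist_le: "(u, v) \<in> edge_rel V E ^^ n \<Longrightarrow> dist\<^sub>G u v \<le> n"
  unfolding gdist_def by (rule Least_le)

lemma gdist_walk:
  assumes "u \<in> V" "v \<in> V"
  shows "(u, v) \<in> edge_rel V E ^^ dist\<^sub>G u v"
proof -
  have "\<exists>n. (u, v) \<in> edge_rel V E ^^ n"
    using connected assms unfolding connected_graph_def by simp
  then show ?thesis
    unfolding gdist_def by (rule LeastI_ex)
qed

lemma gdist_refl [simp]: "dist\<^sub>G u u = 0"
  using gdist_le[of u u 0] by simp

lemma gdist_eq_0: "u \<in> V \<Longrightarrow> v \<in> V \<Longrightarrow> dist\<^sub>G u v = 0 \<longleftrightarrow> u = v"
  using gdist_walk[of u v] by auto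

lemma gdist_triangle:
  assumes "u \<in> V" "v \<in> V" "w \<in> V"
  shows "dist\<^sub>G u w \<le> dist\<^sub>G u v + dist\<^sub>G v w"
proof (rule gdist_le)
  show "(u, w) \<in> edge_rel V E ^^ (dist\<^sub>G u v + dist\<^sub>G v w)"
    unfolding relpow_add using gdist_walk assms by auto
qed

lemma gdist_sym:
  assumes "u \<in> V" "v \<in> V"
  shows "dist\<^sub>G u v = dist\<^sub>G v u"
proof -
  have conv: "(x, y) \<in> edge_rel V E ^^ n \<Longrightarrow> (y, x) \<in> edge_rel V E ^^ n" for x y n
  proof (induction n arbitrary: y)
    case (Suc n)
    then obtain z where z: "(x, z) \<in> edge_rel V E ^^ n" "(z, y) \<in> edge_rel V E"
      by auto
    then have "(y, z) \<in> edge_rel V E"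
      unfolding edge_rel_def using E_sym by auto
    then show ?case
      using Suc.IH[OF z(1)] by (rule relpow_Suc_I2)
  qed auto
  show ?thesis
    using gdist_le[OF conv[OF gdist_walk[OF assms]]] gdist_le[OF conv[OF gdist_walk[OF assms(2,1)]]]
    by simp
qed

text \<open>A step from strictly between \<open>g\<close> and \<open>h\<close> to strictly beyond
  them would cross the edge from \<open>g\<close> to \<open>h\<close>. If \<open>f h < f g\<close>,
  both sides are false, so the edge may be used in either direction.\<close>

lemma noncrossing_walk_between:
  assumes nc: "noncrossing V E f"
    and gh: "g \<in> V" "h \<in> V" "E g h"
    and q: "\<And>i. i < m \<Longrightarrow> (q i, q (Suc i)) \<in> edge_rel V E"
    and avoid: "\<And>i. i \<le> m \<Longrightarrow> q i \<noteq> g \<and> q i \<noteq> h"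
  shows "f g < f (q 0) \<and> f (q 0) < f h \<longleftrightarrow> f g < f (q m) \<and> f (q m) < f h"
  using q avoid
proof (induction m)
  case (Suc m)
  have stays: "f g < f t \<and> f t < f h"
    if st: "s \<in> V" "t \<in> V" "E s t" "t \<noteq> g" "t \<noteq> h" and s: "f g < f s \<and> f s < f h" for s t
  proof (rule ccontr)
    assume "\<not> ?thesis"
    moreover have "f t \<noteq> f g" "f t \<noteq> f h"
      using st gh nc unfolding noncrossing_def inj_on_def by auto
    ultimately consider "f t < f g" | "f h < f t"
      by linarith
    then show False
    proof cases
      case 1
      then show False
        using nc st gh s E_sym unfolding noncrossing_def by blast
    next
      case 2
      then show False
        using nc st gh s unfolding noncrossing_def by blast
    qed
  qed
  have e: "q m \<in> V" "q (Suc m) \<in> V" "E (q m) (q (Suc m))"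
    using Suc.prems(1)[of m] unfolding edge_rel_def by auto
  have ne: "q m \<noteq> g" "q m \<noteq> h" "q (Suc m) \<noteq> g" "q (Suc m) \<noteq> h"
    using Suc.prems(2)[of m] Suc.prems(2)[of "Suc m"] by simp_all
  have "f g < f (q m) \<and> f (q m) < f h \<longleftrightarrow> f g < f (q (Suc m)) \<and> f (q (Suc m)) < f h"
    using stays[OF e ne(3,4)] stays[OF e(2,1) E_sym[OF e(3)] ne(1,2)] by (rule iffI)
  moreover have "f g < f (q 0) \<and> f (q 0) < f h \<longleftrightarrow> f g < f (q m) \<and> f (q m) < f h"
    by (rule Suc.IH) (simp_all add: Suc.prems)
  ultimately show ?case
    by (rule trans[rotated])
qed simp

text \<open>Were the walks disjoint, \<open>p\<close> could never enter the range between
  \<open>q 0\<close> and \<open>q m\<close>: an edge of \<open>p\<close> entering it would have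
  exactly one of \<open>q 0\<close>, \<open>q m\<close> between its ends, although \<open>q\<close>
  avoids those ends. But \<open>p n\<close> lies in that range.\<close>

lemma noncrossing_walks_meet:
  assumes nc: "noncrossing V E f"
    and p: "\<And>i. i < n \<Longrightarrow> (p i, p (Suc i)) \<in> edge_rel V E"
    and q: "\<And>i. i < m \<Longrightarrow> (q i, q (Suc i)) \<in> edge_rel V E"
    and order: "f (p 0) < f (q 0)" "f (q 0) < f (p n)" "f (p n) < f (q m)"
  shows "\<exists>i\<le>n. \<exists>j\<le>m. p i = q j"
proof (rule ccontr)
  assume "\<not> ?thesis"
  then have dis: "p i \<noteq> q j" if "i \<le> n" "j \<le> m" for i j
    using that by blast
  have "m > 0"
    using order by (cases m) auto
  then have qV: "q 0 \<in> V" "q m \<in> V"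
    using q[of 0] q[of "m - 1"] unfolding edge_rel_def by auto
  have "i \<le> n \<Longrightarrow> \<not> (f (q 0) < f (p i) \<and> f (p i) < f (q m))" for i
  proof (induction i)
    case 0
    then show ?case using order by simp
  next
    case (Suc i)
    have e: "p i \<in> V" "p (Suc i) \<in> V" "E (p i) (p (Suc i))"
      using p[of i] Suc.prems unfolding edge_rel_def by auto
    have ne: "f (p i) \<noteq> f (q 0)" "f (p i) \<noteq> f (q m)"
      using nc e(1) qV dis[of i] Suc.prems unfolding noncrossing_def inj_on_def by auto
    have avoid: "q j \<noteq> p i \<and> q j \<noteq> p (Suc i)" if "j \<le> m" for j
      using dis[of i j] dis[of "Suc i" j] that Suc.prems by auto
    show ?case
    proof
      assume in_q: "f (q 0) < f (p (Suc i)) \<and> f (p (Suc i)) < f (q m)"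
      have "f (p i) < f (q 0) \<or> f (q m) < f (p i)"
        using Suc.IH Suc.prems ne by linarith
      then show False
      proof
        assume left: "f (p i) < f (q 0)"
        have "f (p i) < f (q 0) \<and> f (q 0) < f (p (Suc i)) \<longleftrightarrow> f (p i) < f (q m) \<and> f (q m) < f (p (Suc i))"
          by (rule noncrossing_walk_between[OF nc e]) (use q avoid in auto)
        with left in_q show False by simp
      next
        assume right: "f (q m) < f (p i)"
        have "f (p (Suc i)) < f (q 0) \<and> f (q 0) < f (p i) \<longleftrightarrow> f (p (Suc i)) < f (q m) \<and> f (q m) < f (p i)"
          by (rule noncrossing_walk_between[OF nc e(2,1) E_sym[OF e(3)]]) (use q avoid in auto)
        with right in_q show False by simp
      qed
    qed
  qed
  from this[of n] show False
    using order by simp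
qed

lemma noncrossing_geodesics_meet:
  assumes nc: "noncrossing V E f" and V: "a \<in> V" "a' \<in> V" "b \<in> V" "b' \<in> V"
    and order: "f a < f b" "f b < f a'" "f a' < f b'"
  obtains w where "w \<in> V" "dist\<^sub>G a w + dist\<^sub>G w a' = dist\<^sub>G a a'" "dist\<^sub>G b w + dist\<^sub>G w b' = dist\<^sub>G b b'"
proof -
  have on_geodesic: "p i \<in> V \<and> dist\<^sub>G u (p i) + dist\<^sub>G (p i) v = dist\<^sub>G u v"
    if uv: "u \<in> V" "v \<in> V" and p: "p 0 = u" "p (dist\<^sub>G u v) = v"
      "\<And>i. i < dist\<^sub>G u v \<Longrightarrow> (p i, p (Suc i)) \<in> edge_rel V E" and i: "i \<le> dist\<^sub>G u v" for u v p i
  proof -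
    have "(u, p i) \<in> edge_rel V E ^^ i"
      unfolding relpow_fun_conv using p i by (intro exI[of _ p]) auto
    moreover have "(p i, v) \<in> edge_rel V E ^^ (dist\<^sub>G u v - i)"
      unfolding relpow_fun_conv using p i by (intro exI[of _ "\<lambda>j. p (i + j)"]) auto
    moreover have "p i \<in> V"
    proof (cases i)
      case (Suc j)
      then show ?thesis
        using p(3)[of j] i unfolding edge_rel_def by auto
    qed (use p uv in auto)
    ultimately show ?thesis
      using gdist_le[of u "p i" i] gdist_le[of "p i" v "dist\<^sub>G u v - i"] gdist_triangle[of u "p i" v] i uv
      by fastforce
  qed
  obtain p where p: "p 0 = a" "p (dist\<^sub>G a a') = a'"
    "\<And>i. i < dist\<^sub>G a a' \<Longrightarrow> (p i, p (Suc i)) \<in> edge_rel V E"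
    using gdist_walk[OF V(1,2)] unfolding relpow_fun_conv by blast
  obtain q where q: "q 0 = b" "q (dist\<^sub>G b b') = b'"
    "\<And>i. i < dist\<^sub>G b b' \<Longrightarrow> (q i, q (Suc i)) \<in> edge_rel V E"
    using gdist_walk[OF V(3,4)] unfolding relpow_fun_conv by blast
  have "\<exists>i\<le>dist\<^sub>G a a'. \<exists>j\<le>dist\<^sub>G b b'. p i = q j"
    by (rule noncrossing_walks_meet[OF nc]) (use order p q in simp_all)
  then obtain i j where ij: "i \<le> dist\<^sub>G a a'" "j \<le> dist\<^sub>G b b'" "p i = q j"
    by blast
  have "p i \<in> V \<and> dist\<^sub>G a (p i) + dist\<^sub>G (p i) a' = dist\<^sub>G a a'"
    by (rule on_geodesic) (use V p ij in simp_all)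
  moreover have "q j \<in> V \<and> dist\<^sub>G b (q j) + dist\<^sub>G (q j) b' = dist\<^sub>G b b'"
    by (rule on_geodesic) (use V q ij in simp_all)
  ultimately show thesis
    using that[of "p i"] ij(3) by simp
qed

text \<open>Comparing routes from \<open>r\<close> through \<open>w\<close> shows that
  \<open>w\<close> is at least as close to \<open>s\<close> as to \<open>t\<close>. Exchanging the
  tail after \<open>w\<close> of a geodesic from \<open>x\<close> to \<open>t\<close> then leads to
  \<open>s\<close> without becoming longer.\<close>

lemma gdist_le_via:
  assumes V: "r \<in> V" "s \<in> V" "t \<in> V" "w \<in> V" "x \<in> V"
    and w: "dist\<^sub>G r w + dist\<^sub>G w s = dist\<^sub>G r s" "dist\<^sub>G x w + dist\<^sub>G w t = dist\<^sub>G x t"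
    and "dist\<^sub>G r s \<le> dist\<^sub>G r t"
  shows "dist\<^sub>G x s \<le> dist\<^sub>G x t"
  using gdist_triangle[of r w t] gdist_triangle[of x w s] assms by linarith

lemma layer_antitone_left:
  assumes nc: "noncrossing V E f" and r: "r \<in> V" "f r = 0"
    and V: "a \<in> V" "b \<in> V" "x \<in> V" and layer: "dist\<^sub>G r a = dist\<^sub>G r b"
    and order: "f a < f b" "f b \<le> f x"
  shows "dist\<^sub>G x b \<le> dist\<^sub>G x a"
proof (cases "b = x")
  case False
  \<comment> \<open>The layer of \<open>r\<close> contains nothing but \<open>r\<close>, so it
    cannot hold both \<open>a\<close> and \<open>b\<close>.\<close>
  have "a \<noteq> r"
    using layer gdist_eq_0[OF r(1) V(2)] order(1) by auto
  then have "f r < f a" "f b < f x"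
    using nc r V False order unfolding noncrossing_def inj_on_def
    by (metis neq0_conv, metis le_neq_implies_less)
  then obtain w where "w \<in> V" "dist\<^sub>G r w + dist\<^sub>G w b = dist\<^sub>G r b" "dist\<^sub>G a w + dist\<^sub>G w x = dist\<^sub>G a x"
    using noncrossing_geodesics_meet[OF nc r(1) V(2,1,3)] order by blast
  then show ?thesis
    using gdist_le_via[of r b a w x] r V layer gdist_sym[of a w] gdist_sym[of w x] gdist_sym[of a x]
    by auto
qed simp

text \<open>The order now is \<open>r\<close>, \<open>x\<close>, \<open>a\<close>, \<open>b\<close>,
  so a geodesic from \<open>r\<close> to \<open>a\<close> meets one from \<open>x\<close> to
  \<open>b\<close>. If \<open>x = r\<close>, both distances are equal.\<close>

lemma layer_monotone_right:
  assumes nc: "noncrossing V E f" and r: "r \<in> V" "f r = 0"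
    and V: "a \<in> V" "b \<in> V" "x \<in> V" and layer: "dist\<^sub>G r a = dist\<^sub>G r b"
    and order: "f x \<le> f a" "f a < f b"
  shows "dist\<^sub>G x a \<le> dist\<^sub>G x b"
proof -
  consider "x = a" | "x = r" | "x \<noteq> a" "x \<noteq> r" by blast
  then show ?thesis
  proof cases
    case 3
    then have "f r < f x" "f x < f a"
      using nc r V order unfolding noncrossing_def inj_on_def
      by (metis neq0_conv, metis le_neq_implies_less)
    then obtain w where "w \<in> V" "dist\<^sub>G r w + dist\<^sub>G w a = dist\<^sub>G r a" "dist\<^sub>G x w + dist\<^sub>G w b = dist\<^sub>G x b"
      using noncrossing_geodesics_meet[OF nc r(1) V(1,3,2)] order by blast
    then show ?thesis
      using gdist_le_via[of r a b w x] r V layer by auto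
  qed (use layer in auto)
qed

end

section \<open>Counting\<close>

text \<open>At \<open>Max S\<close> this is the minimum of the empty set and carries no information;
  consecutive pairs are therefore indexed by \<open>S - {Max S}\<close>.\<close>

definition next_elem :: "nat set \<Rightarrow> nat \<Rightarrow> nat" where
  "next_elem S s = Min {t \<in> S. s < t}"

lemma next_elem:
  assumes "finite S" "s < t" "t \<in> S"
  shows "next_elem S s \<in> S" "s < next_elem S s" "next_elem S s \<le> t"
proof -
  have "Min {t \<in> S. s < t} \<in> {t \<in> S. s < t}"
    by (rule Min_in) (use assms in auto)
  then show "next_elem S s \<in> S" "s < next_elem S s"
    unfolding next_elem_def by simp_all
  show "next_elem S s \<le> t"
    unfolding next_elem_def by (rule Min_le) (use assms in auto)
qed

lemma next_elem_of_not_Max: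
  assumes "finite S" "s \<in> S - {Max S}"
  shows "next_elem S s \<in> S" "s < next_elem S s"
proof -
  have "s \<le> Max S" "Max S \<in> S"
    using assms by (auto intro: Max_ge Max_in)
  then have "s < Max S" "Max S \<in> S"
    using assms(2) by auto
  from next_elem[OF assms(1) this] show "next_elem S s \<in> S" "s < next_elem S s"
    by simp_all
qed

text \<open>On either side of \<open>x\<close> all changes of \<open>D\<close> are strict and go in
  one direction, so values in \<open>{1..d}\<close> tell them apart: at most \<open>d\<close> on
  each side.\<close>

lemma card_changes_unimodal:
  fixes D :: "nat \<Rightarrow> nat"
  assumes "finite S"
    and left: "\<And>s t. s \<in> S \<Longrightarrow> t \<in> S \<Longrightarrow> s < t \<Longrightarrow> t \<le> x \<Longrightarrow> D t \<le> D s"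
    and right: "\<And>s t. s \<in> S \<Longrightarrow> t \<in> S \<Longrightarrow> s < t \<Longrightarrow> x \<le> s \<Longrightarrow> D s \<le> D t"
    and D: "\<And>s. s \<in> S \<Longrightarrow> s \<noteq> x \<Longrightarrow> D s \<in> {1..d}"
  shows "card {s \<in> S - {Max S}. D (next_elem S s) \<noteq> D s} \<le> 2 * d"
proof -
  let ?n = "next_elem S"
  let ?C = "{s \<in> S - {Max S}. D (?n s) \<noteq> D s}"
  have n: "?n s \<in> S" "s < ?n s" if "s \<in> S - {Max S}" for s
    using next_elem_of_not_Max[OF \<open>finite S\<close> that] .
  have n_le: "?n s \<le> t" if "s < t" "t \<in> S" for s t
    using next_elem[OF \<open>finite S\<close> that] by blast
  \<comment> \<open>A change on the left is labelled by its first value \<open>D s\<close>, one on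
    the right by its second value \<open>D (?n s)\<close>. Neither label is the value at
    \<open>x\<close> itself, which need not lie in \<open>{1..d}\<close>. A pair straddling
    \<open>x\<close> counts as left.\<close>
  let ?L = "{s \<in> ?C. s < x}" and ?R = "{s \<in> ?C. x \<le> s}"
  have L_less: "D t < D s" if "s \<in> ?L" "t \<in> ?L" "s < t" for s t
  proof -
    have "?n s \<le> t"
      using that by (intro n_le) auto
    then have "D (?n s) \<le> D s" "D t \<le> D (?n s)"
      using that n[of s] left[of s "?n s"] left[of "?n s" t] by (auto simp: order.order_iff_strict)
    then show ?thesis
      using that by auto
  qed
  have "inj_on D ?L"
    by (intro linorder_inj_onI') (use L_less in fastforce)
  moreover have "D ` ?L \<subseteq> {1..d}"
    using D by fastforce
  ultimately have cL: "card ?L \<le> d"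
    using card_inj_on_le[of D ?L "{1..d}"] by simp
  have R_less: "D (?n s) < D (?n t)" if "s \<in> ?R" "t \<in> ?R" "s < t" for s t
  proof -
    have "?n s \<le> t"
      using that by (intro n_le) auto
    then have "D (?n s) \<le> D t" "D t \<le> D (?n t)"
      using that n[of s] n[of t] right[of t "?n t"] right[of "?n s" t] by (auto simp: order.order_iff_strict)
    then show ?thesis
      using that by auto
  qed
  have "inj_on (\<lambda>s. D (?n s)) ?R"
    by (intro linorder_inj_onI') (use R_less in fastforce)
  moreover have "(\<lambda>s. D (?n s)) ` ?R \<subseteq> {1..d}"
  proof
    fix y assume "y \<in> (\<lambda>s. D (?n s)) ` ?R"
    then obtain s where s: "s \<in> ?R" "y = D (?n s)" by blast
    then show "y \<in> {1..d}"
      using D[of "?n s"] n[of s] by auto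
  qed
  ultimately have cR: "card ?R \<le> d"
    using card_inj_on_le[of "\<lambda>s. D (?n s)" ?R "{1..d}"] by simp
  have "?C = ?L \<union> ?R" by auto
  then have "card ?C = card (?L \<union> ?R)"
    by (rule arg_cong)
  also have "\<dots> \<le> card ?L + card ?R"
    by (rule card_Un_le)
  finally show ?thesis
    using cL cR by linarith
qed

lemma card_le_if_resolved_unimodal:
  fixes D :: "'b \<Rightarrow> nat \<Rightarrow> nat" and pos :: "'b \<Rightarrow> nat"
  assumes "finite S" "finite X"
    and left: "\<And>x s t. x \<in> X \<Longrightarrow> s \<in> S \<Longrightarrow> t \<in> S \<Longrightarrow> s < t \<Longrightarrow> t \<le> pos x \<Longrightarrow> D x t \<le> D x s"
    and right: "\<And>x s t. x \<in> X \<Longrightarrow> s \<in> S \<Longrightarrow> t \<in> S \<Longrightarrow> s < t \<Longrightarrow> pos x \<le> s \<Longrightarrow> D x s \<le> D x t"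
    and D: "\<And>x s. x \<in> X \<Longrightarrow> s \<in> S \<Longrightarrow> s \<noteq> pos x \<Longrightarrow> D x s \<in> {1..d}"
    and res: "\<And>s t. s \<in> S \<Longrightarrow> t \<in> S \<Longrightarrow> s \<noteq> t \<Longrightarrow> \<exists>x\<in>X. D x s \<noteq> D x t"
  shows "card S \<le> 1 + card X * (2 * d)"
proof (cases "S = {}")
  case False
  let ?C = "\<lambda>x. {s \<in> S - {Max S}. D x (next_elem S s) \<noteq> D x s}"
  have "S - {Max S} \<subseteq> (\<Union>x\<in>X. ?C x)"
  proof
    fix s assume s: "s \<in> S - {Max S}"
    from next_elem_of_not_Max[OF \<open>finite S\<close> s] show "s \<in> (\<Union>x\<in>X. ?C x)"
      using res[of "next_elem S s" s] s by auto
  qed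
  then have "card (S - {Max S}) \<le> card (\<Union>x\<in>X. ?C x)"
    using \<open>finite S\<close> \<open>finite X\<close> by (intro card_mono) auto
  also have "\<dots> \<le> (\<Sum>x\<in>X. card (?C x))"
    by (rule card_UN_le[OF \<open>finite X\<close>])
  also have "\<dots> \<le> (\<Sum>x\<in>X. 2 * d)"
    by (intro sum_mono card_changes_unimodal[where x = "pos _"] \<open>finite S\<close> left right D)
  also have "\<dots> = card X * (2 * d)" by simp
  finally show ?thesis
    using card_Diff_singleton[of "Max S" S] \<open>finite S\<close> False by simp
qed simp

section \<open>Layer sizes and the final bound\<close>

lemma (in connected_simple_graph) card_layer_le:
  assumes nc: "noncrossing V E f" and r: "r \<in> R" "f r = 0" and R: "resolving_set V E R"
    and d: "\<And>u v. u \<in> V \<Longrightarrow> v \<in> V \<Longrightarrow> dist\<^sub>G u v \<le> d"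
  shows "card {v \<in> V. dist\<^sub>G r v = i} \<le> 1 + card (R - {r}) * (2 * d)"
proof -
  let ?L = "{v \<in> V. dist\<^sub>G r v = i}"
  \<comment> \<open>Layers are counted through their positions; \<open>g\<close> leads back from a
    position to its vertex.\<close>
  define g where "g = the_inv_into V f"
  have g: "g (f v) = v" if "v \<in> V" for v
    using that nc unfolding g_def noncrossing_def by (simp add: the_inv_into_f_f)
  have RV: "R \<subseteq> V"
    using R unfolding resolving_set_def by simp
  have fin: "finite V"
    using simple unfolding simple_graph_def by simp
  have "card (f ` ?L) \<le> 1 + card (R - {r}) * (2 * d)"
  proof (rule card_le_if_resolved_unimodal[where D = "\<lambda>x n. dist\<^sub>G x (g n)" and pos = f])
    fix x s t assume "x \<in> R - {r}" "s \<in> f ` ?L" "t \<in> f ` ?L" "s < t"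
    then obtain a b where ab: "s = f a" "t = f b" "a \<in> ?L" "b \<in> ?L" "x \<in> V" "f a < f b"
      using RV by auto
    show "dist\<^sub>G x (g t) \<le> dist\<^sub>G x (g s)" if "t \<le> f x"
      using layer_antitone_left[OF nc _ r(2), of a b x] that ab g r RV by auto
    show "dist\<^sub>G x (g s) \<le> dist\<^sub>G x (g t)" if "f x \<le> s"
      using layer_monotone_right[OF nc _ r(2), of a b x] that ab g r RV by auto
  next
    fix x s assume "x \<in> R - {r}" "s \<in> f ` ?L" "s \<noteq> f x"
    then obtain a where "s = f a" "a \<in> V" "x \<in> V" "a \<noteq> x"
      using RV by auto
    then show "dist\<^sub>G x (g s) \<in> {1..d}"
      using d[of x a] gdist_eq_0[of x a] g by auto
  next
    fix s t assume "s \<in> f ` ?L" "t \<in> f ` ?L" "s \<noteq> t"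
    then obtain a b where ab: "s = f a" "t = f b" "a \<in> ?L" "b \<in> ?L" "a \<noteq> b"
      by auto
    then obtain x where "x \<in> R" "dist\<^sub>G x a \<noteq> dist\<^sub>G x b"
      using R unfolding resolving_set_def by blast
    \<comment> \<open>The resolving vertex differs from \<open>r\<close>, as \<open>r\<close> is at
      distance \<open>i\<close> from both.\<close>
    then show "\<exists>x\<in>R - {r}. dist\<^sub>G x (g s) \<noteq> dist\<^sub>G x (g t)"
      using ab g by (intro bexI[of _ x]) auto
  qed (use fin RV finite_subset in auto)
  moreover have "inj_on f ?L"
    using nc unfolding noncrossing_def inj_on_def by auto
  ultimately show ?thesis
    by (simp add: card_image)
qed

theorem theorem7:
  fixes V :: "'a set" and E :: "'a \<Rightarrow> 'a \<Rightarrow> bool" and R :: "'a set" and d k :: nat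
  assumes "simple_graph V E"
    and "outerplanar V E"
    and "has_diameter V E d"
    and "resolving_set V E R" and "card R = k"
  shows "int (card V) \<le> 2 * int k * int d ^ 2 - 2 * int d ^ 2 + int d + 1"
proof -
  interpret connected_simple_graph V E
    using assms(1,3) by unfold_locales (auto simp: has_diameter_def)
  have fin: "finite V"
    using simple unfolding simple_graph_def by simp
  have RV: "R \<subseteq> V"
    using assms(4) unfolding resolving_set_def by simp
  have dists: "finite {dist\<^sub>G u v | u v. u \<in> V \<and> v \<in> V}"
    using fin by (auto intro: finite_image_set2)
  have d: "dist\<^sub>G u v \<le> d" if "u \<in> V" "v \<in> V" for u v
    using assms(3) Max_ge[OF dists, of "dist\<^sub>G u v"] that unfolding has_diameter_def by auto
  show ?thesis
  proof (cases "R = {}")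
    case True
    \<comment> \<open>An empty set resolves only a single vertex; then \<open>d = 0\<close> and the
      claimed bound is 1.\<close>
    then have single: "u = v" if "u \<in> V" "v \<in> V" for u v
      using assms(4) that unfolding resolving_set_def by blast
    obtain v where "v \<in> V"
      using assms(3) unfolding has_diameter_def by blast
    then have "V = {v}"
      using single by blast
    then have "card V = 1" by simp
    moreover have "d \<in> {dist\<^sub>G u v | u v. u \<in> V \<and> v \<in> V}"
      using Max_in[OF dists] \<open>v \<in> V\<close> assms(3) unfolding has_diameter_def by blast
    then obtain u w where "d = dist\<^sub>G u w" "u \<in> V" "w \<in> V"
      by auto
    then have "d = 0"
      using single[of u w] gdist_refl[of w] by simp
    ultimately show ?thesis by simp
  next
    case False
    then obtain r where r: "r \<in> R" by blast
    obtain pos \<gamma> where "planar_drawing V E pos \<gamma>"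
      "\<forall>v\<in>V. pos v \<in> closure (outside (drawing_image V E pos \<gamma>))"
      using assms(2) unfolding outerplanar_def by blast
    then interpret outerplanar_drawing V E pos \<gamma>
      using simple by unfold_locales auto
    obtain f where f: "noncrossing V E f" "f r = 0"
      using exists_noncrossing[of V r] r RV by auto
    let ?L = "\<lambda>i. {v \<in> V. dist\<^sub>G r v = i}"
    let ?c = "card (R - {r}) * (2 * d)"
    have "V = (\<Union>i\<le>d. ?L i)"
      using d[of r] r RV by auto
    then have "card V \<le> (\<Sum>i\<le>d. card (?L i))"
      using card_UN_le[of "{..d}" ?L] by simp
    \<comment> \<open>Layer 0 is split off because it has only one vertex, where the general layer
      bound would be wasteful.\<close>
    also have "\<dots> = card (?L 0) + (\<Sum>i=1..d. card (?L i))"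
      by (simp add: atMost_atLeast0 sum.atLeast_Suc_atMost)
    also have "?L 0 = {r}"
      using r RV gdist_eq_0[of r] by auto
    also have "(\<Sum>i=1..d. card (?L i)) \<le> (\<Sum>i=1..d. 1 + ?c)"
      by (intro sum_mono card_layer_le[OF f(1) r f(2) assms(4)] d)
    finally have "card V \<le> 1 + d * (1 + ?c)"
      by simp
    \<comment> \<open>The passage to integers comes before \<open>k - 1\<close> appears, so that
      expanding the product involves no truncated subtraction.\<close>
    then have "int (card V) \<le> int (1 + d * (1 + ?c))"
      by (rule of_nat_mono)
    also have "\<dots> = 1 + int d * (1 + int (card (R - {r})) * (2 * int d))"
      by (simp add: algebra_simps)
    also have "\<dots> = 1 + int d * (1 + (int k - 1) * (2 * int d))"
      using card_Suc_Diff1[of R r] finite_subset[OF RV fin] r assms(5) by auto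
    also have "\<dots> = 2 * int k * int d ^ 2 - 2 * int d ^ 2 + int d + 1"
      by (simp add: algebra_simps power2_eq_square)
    finally show ?thesis .
  qed
qed

end
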